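(* Let $(M,g,\boldsymbol{\tau})$ be a spacetime. Then the null tangent bundle $\mathcal{N}M$ comes with a smooth action of the multiplicative group of strictly positive real numbers $(\mathbb{R}_{>0},\cdot)$, $$\mathrm{h} : \mathbb{R}_{>0}\times \mathcal{N}M \longrightarrow \mathcal{N}M,$$ given in the natural local coordinates $(x^\mu, v^i_\pm)$ on $\mathcal{N}M$ by $$\mathrm{h}_\lambda^*(x^\mu, v_\pm^i) = (x^\mu, \lambda\, v_\pm^i).$$
   Context: A spacetime $(M,g,\boldsymbol{\tau})$ is a connected four-dimensional smooth manifold $M$ with a Lorentzian metric $g$ of signature $(-,+,+,+)$ and a chosen timelike vector field $\boldsymbol{\tau}$ (the time-orientation), i.e. $g_p(\boldsymbol{\tau}|_p,\boldsymbol{\tau}|_p)<0$ at every $p\in M$. A vector $v\in T_pM$ is null if $g_p(v,v)=0$; it is future directed if $g_p(v,\boldsymbol{\tau}|_p)<0$ and past directed if $g_p(v,\boldsymbol{\tau}|_p)>0$. Let $\mathcal{N}_p\subset T_pM$ be the set of null vectors at $p$. The null tangent bundle is $\mathcal{N}M=\bigsqcup_{p\in M}\mathcal{N}_p\setminus\{\mathbf{0}_p\}$ with projection $\pi(p,v)=p$. Natural coordinates and smooth structure on $\mathcal{N}M$: over a chart domain $U\subset M$ with coordinates $x^\mu$ and a smooth $g$-orthonormal frame (vierbein) $e_0,e_1,e_2,e_3$ with $e_0$ future directed timelike, a non-zero null vector $v_\pm = v_\pm^a e_a|_p$ (with $+$ if future directed and $-$ if past directed) has coordinates $(x^\mu,v_\pm^i)$,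 $i=1,2,3$, with $(v_\pm^i) \in \mathbb{R}^3\setminus\{0\}$ and $v_\pm^0=\pm\sqrt{v_\pm^jv_\pm^k\delta_{kj}}$. Under a change of chart and a restricted Lorentz change of frame with matrix $\Lambda$, the coordinates change by $$x^{\mu'}=x^{\mu'}(x),\qquad v_\pm^{i'} = v_\pm^i\,\Lambda_i^{\ i'}(x) \pm \sqrt{v_\pm^jv_\pm^k\delta_{kj}}\;\Lambda_0^{\ i'}(x).$$ With these charts $\mathcal{N}M$ is a smooth manifold. $\mathrm{h}_\lambda := \mathrm{h}(\lambda,\cdot)$. *)

theory Defs
  imports "HOL-Analysis.Analysis" "HOL-Algebra.Group_Action"
begin

section \<open>Smooth maps between open subsets of Euclidean spaces\<close>

text \<open>Only used for open sets \<open>S\<close>: derivatives are taken in the full neighbourhood filter.\<close>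

primrec ck_on :: "nat \<Rightarrow> 'e::euclidean_space set \<Rightarrow> ('e \<Rightarrow> 'f::euclidean_space) \<Rightarrow> bool" where
  "ck_on 0 S f \<longleftrightarrow> continuous_on S f"
| "ck_on (Suc k) S f \<longleftrightarrow> (\<forall>x\<in>S. f differentiable (at x)) \<and>
     (\<forall>v. ck_on k S (\<lambda>x. frechet_derivative f (at x) v))"

definition smooth_on :: "'e::euclidean_space set \<Rightarrow> ('e \<Rightarrow> 'f::euclidean_space) \<Rightarrow> bool" where
  "smooth_on S f \<longleftrightarrow> (\<forall>k. ck_on k S f)"


section \<open>Smooth manifolds\<close>

text \<open>A chart is a domain together with a coordinate map, whose values outside the domain are
  irrelevant. A maximal atlas contains every such representative of each of its charts.\<close>

type_synonym ('a, 'e) chart = "'a set \<times> ('a \<Rightarrow> 'e)"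

definition chart_inv :: "('a, 'e) chart \<Rightarrow> 'e \<Rightarrow> 'a" where
  "chart_inv c = inv_into (fst c) (snd c)"

definition transition :: "('a, 'e) chart \<Rightarrow> ('a, 'f) chart \<Rightarrow> 'e \<Rightarrow> 'f" where
  "transition c d = snd d \<circ> chart_inv c"

definition topological_chart :: "'a topology \<Rightarrow> ('a, 'e::euclidean_space) chart \<Rightarrow> bool" where
  "topological_chart X c \<longleftrightarrow> openin X (fst c) \<and> open (snd c ` fst c) \<and>
     homeomorphic_map (subtopology X (fst c)) (top_of_set (snd c ` fst c)) (snd c)"

definition smoothly_compatible ::
    "('a, 'e::euclidean_space) chart \<Rightarrow> ('a, 'e) chart \<Rightarrow> bool" where
  "smoothly_compatible c d \<longleftrightarrow>
     smooth_on (snd c ` (fst c \<inter> fst d)) (transition c d) \<and>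
     smooth_on (snd d ` (fst c \<inter> fst d)) (transition d c)"

definition maximal_smooth_atlas ::
    "'a topology \<Rightarrow> ('a, 'e::euclidean_space) chart set \<Rightarrow> bool" where
  "maximal_smooth_atlas X A \<longleftrightarrow>
     (\<forall>c\<in>A. topological_chart X c) \<and>
     \<Union> (fst ` A) = topspace X \<and>
     (\<forall>c\<in>A. \<forall>d\<in>A. smoothly_compatible c d) \<and>
     (\<forall>c. topological_chart X c \<longrightarrow> (\<forall>d\<in>A. smoothly_compatible c d) \<longrightarrow> c \<in> A)"

definition smooth_manifold :: "'a topology \<Rightarrow> ('a, 'e::euclidean_space) chart set \<Rightarrow> bool" where
  "smooth_manifold X A \<longleftrightarrow>
     Hausdorff_space X \<and> second_countable X \<and> maximal_smooth_atlas X A"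

text \<open>Smoothness of \<open>F : S \<rightarrow> T\<close> with respect to not necessarily maximal atlases \<open>A\<close> of \<open>S\<close> and
  \<open>B\<close> of \<open>T\<close>, for the topologies induced by these atlases: continuity is expressed by openness of
  the coordinate images of the preimages of chart domains.\<close>

definition smooth_map ::
    "'a set \<Rightarrow> ('a, 'e::euclidean_space) chart set \<Rightarrow>
     'b set \<Rightarrow> ('b, 'f::euclidean_space) chart set \<Rightarrow> ('a \<Rightarrow> 'b) \<Rightarrow> bool" where
  "smooth_map S A T B F \<longleftrightarrow>
     F ` S \<subseteq> T \<and> \<Union> (fst ` A) = S \<and> \<Union> (fst ` B) = T \<and>
     (\<forall>(U, \<phi>)\<in>A. \<forall>(V, \<psi>)\<in>B.
        open (\<phi> ` {p \<in> U. F p \<in> V}) \<and>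
        smooth_on (\<phi> ` {p \<in> U. F p \<in> V}) (\<psi> \<circ> F \<circ> inv_into U \<phi>))"

definition product_atlas ::
    "('a, 'e) chart set \<Rightarrow> ('b, 'f) chart set \<Rightarrow> ('a \<times> 'b, 'e \<times> 'f) chart set" where
  "product_atlas A B = {(U \<times> V, map_prod \<phi> \<psi>) | U \<phi> V \<psi>. (U, \<phi>) \<in> A \<and> (V, \<psi>) \<in> B}"


section \<open>Tangent vectors\<close>

text \<open>A tangent vector at \<open>p\<close> is a family of component vectors, one for each chart around \<open>p\<close>,
  related by the Jacobians of the chart transitions (and \<open>0\<close> at all other charts, so that equality
  of tangent vectors is equality of functions).\<close>

type_synonym ('a, 'e) tvec = "('a, 'e) chart \<Rightarrow> 'e"

definition tangent_space ::
    "('a, 'e::euclidean_space) chart set \<Rightarrow> 'a \<Rightarrow> ('a, 'e) tvec set" where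
  "tangent_space A p = {v.
     (\<forall>c\<in>A. \<forall>d\<in>A. p \<in> fst c \<longrightarrow> p \<in> fst d \<longrightarrow>
        v d = frechet_derivative (transition c d) (at (snd c p)) (v c)) \<and>
     (\<forall>c. c \<notin> A \<or> p \<notin> fst c \<longrightarrow> v c = 0)}"

definition tzero :: "('a, 'e::euclidean_space) tvec" where
  "tzero = (\<lambda>c. 0)"

definition tadd :: "('a, 'e::euclidean_space) tvec \<Rightarrow> ('a, 'e) tvec \<Rightarrow> ('a, 'e) tvec" where
  "tadd v w = (\<lambda>c. v c + w c)"

definition tscale :: "real \<Rightarrow> ('a, 'e::euclidean_space) tvec \<Rightarrow> ('a, 'e) tvec" where
  "tscale r v = (\<lambda>c. r *\<^sub>R v c)"

text \<open>The tangent vector at \<open>p\<close> with components \<open>a\<close> in the chart \<open>c\<close>; for \<open>a\<close> in the standard basis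
  these are the coordinate vectors of \<open>c\<close>.\<close>

definition coord_tvec ::
    "('a, 'e::euclidean_space) chart set \<Rightarrow> ('a, 'e) chart \<Rightarrow> 'a \<Rightarrow> 'e \<Rightarrow> ('a, 'e) tvec" where
  "coord_tvec A c p a = (\<lambda>d. if d \<in> A \<and> p \<in> fst d
     then frechet_derivative (transition c d) (at (snd c p)) a else 0)"

definition smooth_vector_field ::
    "('a, 'e::euclidean_space) chart set \<Rightarrow> 'a set \<Rightarrow> ('a \<Rightarrow> ('a, 'e) tvec) \<Rightarrow> bool" where
  "smooth_vector_field A U W \<longleftrightarrow>
     (\<forall>p\<in>U. W p \<in> tangent_space A p) \<and>
     (\<forall>c\<in>A. smooth_on (snd c ` (fst c \<inter> U)) (\<lambda>x. W (chart_inv c x) c))"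


section \<open>Lorentzian metrics and spacetimes\<close>

type_synonym 'a tv = "('a, real^4) tvec"
type_synonym 'a metric = "'a \<Rightarrow> 'a tv \<Rightarrow> 'a tv \<Rightarrow> real"

definition symmetric_bilinear_on_tangent ::
    "('a, real^4) chart set \<Rightarrow> 'a metric \<Rightarrow> 'a \<Rightarrow> bool" where
  "symmetric_bilinear_on_tangent A g p \<longleftrightarrow>
     (\<forall>u\<in>tangent_space A p. \<forall>v\<in>tangent_space A p. g p u v = g p v u) \<and>
     (\<forall>u\<in>tangent_space A p. \<forall>v\<in>tangent_space A p. \<forall>w\<in>tangent_space A p. \<forall>r s.
        g p (tadd (tscale r u) (tscale s v)) w = r * g p u w + s * g p v w)"

text \<open>The timelike leg \<open>e0\<close> is kept apart from the spatial legs \<open>e i\<close>, \<open>i :: 3\<close>.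
  As the tangent space is four-dimensional, orthonormality already makes these vectors a basis.\<close>

definition orthonormal_at ::
    "('a, real^4) chart set \<Rightarrow> 'a metric \<Rightarrow> 'a \<Rightarrow> 'a tv \<Rightarrow> (3 \<Rightarrow> 'a tv) \<Rightarrow> bool" where
  "orthonormal_at A g p e0 e \<longleftrightarrow>
     e0 \<in> tangent_space A p \<and> (\<forall>i. e i \<in> tangent_space A p) \<and>
     g p e0 e0 = - 1 \<and> (\<forall>i. g p e0 (e i) = 0) \<and>
     (\<forall>i j. g p (e i) (e j) = (if i = j then 1 else 0))"

definition lorentzian_metric ::
    "'a topology \<Rightarrow> ('a, real^4) chart set \<Rightarrow> 'a metric \<Rightarrow> bool" where
  "lorentzian_metric X A g \<longleftrightarrow>
     (\<forall>p\<in>topspace X. symmetric_bilinear_on_tangent A g p \<and> (\<exists>e0 e. orthonormal_at A g p e0 e)) \<and>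
     (\<forall>c\<in>A. \<forall>a\<in>Basis. \<forall>b\<in>Basis.
        smooth_on (snd c ` fst c)
          (\<lambda>x. let p = chart_inv c x in g p (coord_tvec A c p a) (coord_tvec A c p b)))"

definition spacetime ::
    "'a topology \<Rightarrow> ('a, real^4) chart set \<Rightarrow> 'a metric \<Rightarrow> ('a \<Rightarrow> 'a tv) \<Rightarrow> bool" where
  "spacetime X A g \<tau> \<longleftrightarrow>
     smooth_manifold X A \<and> connected_space X \<and>
     lorentzian_metric X A g \<and>
     smooth_vector_field A (topspace X) \<tau> \<and>
     (\<forall>p\<in>topspace X. g p (\<tau> p) (\<tau> p) < 0)"

definition future_directed :: "'a metric \<Rightarrow> ('a \<Rightarrow> 'a tv) \<Rightarrow> 'a \<Rightarrow> 'a tv \<Rightarrow> bool" where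
  "future_directed g \<tau> p v \<longleftrightarrow> g p v (\<tau> p) < 0"

definition past_directed :: "'a metric \<Rightarrow> ('a \<Rightarrow> 'a tv) \<Rightarrow> 'a \<Rightarrow> 'a tv \<Rightarrow> bool" where
  "past_directed g \<tau> p v \<longleftrightarrow> g p v (\<tau> p) > 0"


section \<open>The null tangent bundle and its natural coordinates\<close>

definition null_vectors :: "('a, real^4) chart set \<Rightarrow> 'a metric \<Rightarrow> 'a \<Rightarrow> 'a tv set" where
  "null_vectors A g p = {v \<in> tangent_space A p. g p v v = 0}"

definition null_bundle ::
    "'a topology \<Rightarrow> ('a, real^4) chart set \<Rightarrow> 'a metric \<Rightarrow> ('a \<times> 'a tv) set" where
  "null_bundle X A g = (SIGMA p:topspace X. null_vectors A g p - {tzero})"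

definition future_frame ::
    "('a, real^4) chart set \<Rightarrow> 'a metric \<Rightarrow> ('a \<Rightarrow> 'a tv) \<Rightarrow> 'a set \<Rightarrow>
     ('a \<Rightarrow> 'a tv) \<Rightarrow> (3 \<Rightarrow> 'a \<Rightarrow> 'a tv) \<Rightarrow> bool" where
  "future_frame A g \<tau> U e0 e \<longleftrightarrow>
     smooth_vector_field A U e0 \<and> (\<forall>i. smooth_vector_field A U (e i)) \<and>
     (\<forall>p\<in>U. orthonormal_at A g p (e0 p) (\<lambda>i. e i p) \<and> future_directed g \<tau> p (e0 p))"

definition spatial_components :: "'a tv \<Rightarrow> (3 \<Rightarrow> 'a tv) \<Rightarrow> 'a tv \<Rightarrow> real^3" where
  "spatial_components e0 e v =
     (THE w. \<exists>w0. v = (\<lambda>c. w0 *\<^sub>R e0 c + (\<Sum>i\<in>UNIV. w $ i *\<^sub>R e i c)))"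

text \<open>Over each framed chart domain there is one natural chart for the future directed and one for
  the past directed null vectors.\<close>

definition natural_charts ::
    "'a topology \<Rightarrow> ('a, real^4) chart set \<Rightarrow> 'a metric \<Rightarrow> ('a \<Rightarrow> 'a tv) \<Rightarrow>
     ('a \<times> 'a tv, (real^4) \<times> (real^3)) chart set" where
  "natural_charts X A g \<tau> =
     {({(p, v) \<in> null_bundle X A g. p \<in> U \<and> directed g \<tau> p v},
       \<lambda>(p, v). (x p, spatial_components (e0 p) (\<lambda>i. e i p) v)) | U x e0 e directed.
       (U, x) \<in> A \<and> future_frame A g \<tau> U e0 e \<and> directed \<in> {future_directed, past_directed}}"


section \<open>The multiplicative group of positive reals\<close>

definition pos_reals :: "real monoid" where
  "pos_reals = \<lparr>carrier = {0<..}, monoid.mult = (*), one = 1\<rparr>"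

definition pos_reals_atlas :: "(real, real) chart set" where
  "pos_reals_atlas = {({0<..}, \<lambda>r. r)}"

end

theory Submission
  imports Defs
begin

text \<open>
  The action multiplies each null vector by a positive number: \<open>h l (p, v) = (p, l v)\<close>. The group
  laws and the formula in natural coordinates are immediate, because the metric and the components
  with respect to a frame are homogeneous in \<open>v\<close>. The substance of the theorem is that the natural
  charts cover the null tangent bundle and that the action is smooth in them.

  Covering (\<open>natural_charts_cover\<close>). Around every point there must be a chart with a smooth
  orthonormal frame whose timelike leg is future directed. An orthonormal basis at one point is
  extended by constant components in a chart and orthonormalised by the Gram-Schmidt procedure; on
  a small neighbourhood this succeeds and depends smoothly on the point (\<open>extend_orthonormal\<close>,
  \<open>exists_framed_chart\<close>). Moreover a non-zero null vector must be future or past directed: in the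
  frame its time component is plus or minus the length of its spatial part, whereas the time
  component of \<open>\<tau>\<close> exceeds its spatial part, so by the Cauchy-Schwarz inequality the product with
  \<open>\<tau>\<close> does not vanish and has a sign given by that choice (\<open>null_direction\<close>, \<open>null_form\<close>).

  Smoothness (\<open>smooth_map_rescale\<close>). Rescaling by \<open>l > 0\<close> preserves the time direction, so only
  two charts of the same direction \<open>s = \<plusminus>1\<close> interact. Over the overlap of their domains the first
  chart has the range \<open>x(U \<inter> V) \<times> (\<real>\<^sup>3 - {0})\<close> (\<open>rescale_chart_domain\<close>), and since the
  spatial components in an orthonormal frame are inner products with its spatial legs, the action
  reads \<open>(l, x, w) \<mapsto> (y(x), l (s |w| g(e0, f i) + (\<Sum>j. w j g(e j, f i))))\<close>. This is smooth because
  \<open>|w|\<close> is smooth away from \<open>0\<close>. Smoothness of all these expressions follows from closure of smooth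
  maps under composition and bilinear operations, which the first part establishes by induction on
  the order of differentiability.
\<close>


section \<open>Calculus of smooth maps\<close>

lemma ck_on_cong:
  assumes "open S" and "\<And>x. x \<in> S \<Longrightarrow> f x = g x" and "ck_on k S f"
  shows "ck_on k S g"
  using assms(2,3)
proof (induction k arbitrary: f g)
  case 0
  then show ?case by (simp cong: continuous_on_cong)
next
  case (Suc k)
  have fd: "frechet_derivative f (at x) = frechet_derivative g (at x)" if "x \<in> S" for x
    using Suc.prems that assms(1) by (auto intro!: frechet_derivative_transform_within_open)
  have "g differentiable (at x)" if "x \<in> S" for x
  proof -
    have "(f has_derivative frechet_derivative f (at x)) (at x)"
      using Suc.prems that frechet_derivative_works by auto
    then have "(g has_derivative frechet_derivative f (at x)) (at x)"
      using assms(1) that Suc.prems(1) by (auto intro: has_derivative_transform_within_open)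
    then show ?thesis unfolding differentiable_def by blast
  qed
  moreover have "ck_on k S (\<lambda>x. frechet_derivative g (at x) v)" for v
    by (rule Suc.IH[of "\<lambda>x. frechet_derivative f (at x) v"]) (use Suc.prems fd in auto)
  ultimately show ?case by simp
qed

lemma ck_on_subset: "ck_on k S f \<Longrightarrow> T \<subseteq> S \<Longrightarrow> ck_on k T f"
  by (induction k arbitrary: f) (auto intro: continuous_on_subset)

text \<open>Derivatives can be supplied in any convenient form in place of \<open>frechet_derivative\<close>.\<close>

lemma ck_on_SucI:
  assumes "open S" and "\<And>x. x \<in> S \<Longrightarrow> (f has_derivative f' x) (at x)"
    and "\<And>v. ck_on k S (\<lambda>x. f' x v)"
  shows "ck_on (Suc k) S f"
proof -
  have "frechet_derivative f (at x) = f' x" if "x \<in> S" for x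
    using assms(2)[OF that] frechet_derivative_at by metis
  then show ?thesis
    using assms ck_on_cong[OF assms(1) _ assms(3)] by (auto simp: differentiable_def)
qed

lemma ck_on_SucD:
  assumes "ck_on (Suc k) S f"
  shows "x \<in> S \<Longrightarrow> (f has_derivative frechet_derivative f (at x)) (at x)"
    and "ck_on k S (\<lambda>x. frechet_derivative f (at x) v)"
  using assms frechet_derivative_works by auto

lemma ck_on_imp_continuous_on:
  assumes "ck_on k S f"
  shows "continuous_on S f"
proof (cases k)
  case (Suc j)
  then have "f differentiable_on S"
    using assms by (simp add: differentiable_at_imp_differentiable_on)
  then show ?thesis by (rule differentiable_imp_continuous_on)
qed (use assms in simp)

lemma ck_on_Suc_imp: "ck_on (Suc k) S f \<Longrightarrow> ck_on k S f"
proof (induction k arbitrary: f)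
  case 0
  from ck_on_imp_continuous_on[OF this] show ?case by simp
next
  case (Suc k)
  have "f differentiable (at x)" if "x \<in> S" for x
    using Suc.prems that unfolding ck_on.simps(2)[of "Suc k"] by blast
  moreover have "ck_on k S (\<lambda>x. frechet_derivative f (at x) v)" for v
    using Suc.prems unfolding ck_on.simps(2)[of "Suc k"] by (blast intro: Suc.IH)
  ultimately show ?case unfolding ck_on.simps(2)[of k] by blast
qed

lemma ck_on_const: "ck_on k S (\<lambda>x. c)"
  by (induction k arbitrary: c) auto

lemma ck_on_bounded_linear:
  assumes "bounded_linear L" and "open S" and "ck_on k S f"
  shows "ck_on k S (\<lambda>x. L (f x))"
  using assms(3)
proof (induction k arbitrary: f)
  case 0
  then show ?case
    using bounded_linear.continuous_on[OF assms(1)] by simp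
next
  case (Suc k)
  show ?case
  proof (rule ck_on_SucI[OF assms(2)])
    show "((\<lambda>x. L (f x)) has_derivative (\<lambda>v. L (frechet_derivative f (at x) v))) (at x)" if "x \<in> S" for x
      using bounded_linear.has_derivative[OF assms(1) ck_on_SucD(1)[OF Suc.prems that]] .
    show "ck_on k S (\<lambda>x. L (frechet_derivative f (at x) v))" for v
      using Suc.IH ck_on_SucD(2)[OF Suc.prems] by blast
  qed
qed

lemma ck_on_add:
  assumes "open S" and "ck_on k S f" and "ck_on k S g"
  shows "ck_on k S (\<lambda>x. f x + g x)"
  using assms(2,3)
proof (induction k arbitrary: f g)
  case 0
  then show ?case by (simp add: continuous_on_add)
next
  case (Suc k)
  show ?case
    by (rule ck_on_SucI[OF assms(1) has_derivative_add[OF ck_on_SucD(1) ck_on_SucD(1)]])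
      (use Suc ck_on_SucD in auto)
qed

lemma ck_on_bounded_bilinear:
  assumes "bounded_bilinear B" and "open S" and "ck_on k S f" and "ck_on k S g"
  shows "ck_on k S (\<lambda>x. B (f x) (g x))"
  using assms(3,4)
proof (induction k arbitrary: f g)
  case 0
  then show ?case using bounded_bilinear.continuous_on[OF assms(1)] by auto
next
  case (Suc k)
  show ?case
  proof (rule ck_on_SucI[OF assms(2)])
    show "((\<lambda>x. B (f x) (g x)) has_derivative
        (\<lambda>v. B (f x) (frechet_derivative g (at x) v) + B (frechet_derivative f (at x) v) (g x))) (at x)"
      if "x \<in> S" for x
      using bounded_bilinear.FDERIV[OF assms(1) ck_on_SucD(1)[OF Suc.prems(1) that]
          ck_on_SucD(1)[OF Suc.prems(2) that]] .
    show "ck_on k S (\<lambda>x. B (f x) (frechet_derivative g (at x) v) +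
        B (frechet_derivative f (at x) v) (g x))" for v
      by (intro ck_on_add[OF assms(2)] Suc.IH)
        (use Suc.prems ck_on_Suc_imp ck_on_SucD(2) in blast)+
  qed
qed

lemma ck_on_sum:
  assumes "open S" and "\<And>i. i \<in> I \<Longrightarrow> ck_on k S (f i)"
  shows "ck_on k S (\<lambda>x. \<Sum>i\<in>I. f i x)"
proof (cases "finite I")
  case True
  then show ?thesis using assms(2)
    by (induction I rule: finite_induct) (auto intro: ck_on_add[OF assms(1)] ck_on_const)
qed (simp add: ck_on_const)

text \<open>The chain rule gives the derivative of \<open>g \<circ> f\<close> as \<open>g'\<close> at \<open>f x\<close> applied to a vector that itself
  depends on \<open>x\<close>. Expanding this vector in the basis yields a sum of products of functions with
  one derivative less, to which the induction hypothesis applies.\<close>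

lemma ck_on_compose:
  assumes "open S" and "open T" and "f ` S \<subseteq> T" and "ck_on k S f" and "ck_on k T g"
  shows "ck_on k S (\<lambda>x. g (f x))"
  using assms(4,5)
proof (induction k arbitrary: g)
  case 0
  then show ?case using continuous_on_compose2[of T g S f] assms(3) by simp
next
  case (Suc k)
  let ?D = "\<lambda>x v. frechet_derivative f (at x) v"
  let ?E = "\<lambda>y v. frechet_derivative g (at y) v"
  show ?case
  proof (rule ck_on_SucI[OF assms(1)])
    fix x assume x: "x \<in> S"
    have dg: "(g has_derivative ?E (f x)) (at (f x))"
      using ck_on_SucD(1)[OF Suc.prems(2)] x assms(3) by blast
    have "((\<lambda>x. g (f x)) has_derivative (\<lambda>v. ?E (f x) (?D x v))) (at x)"
      using has_derivative_compose[OF ck_on_SucD(1)[OF Suc.prems(1) x] dg] .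
    moreover have "?E (f x) (?D x v) = (\<Sum>b\<in>Basis. (?D x v \<bullet> b) *\<^sub>R ?E (f x) b)" for v
    proof -
      interpret linear "?E (f x)" using dg has_derivative_linear by blast
      show ?thesis by (subst (1) euclidean_representation[symmetric]) (simp add: sum scale)
    qed
    ultimately show "((\<lambda>x. g (f x)) has_derivative
        (\<lambda>v. \<Sum>b\<in>Basis. (?D x v \<bullet> b) *\<^sub>R ?E (f x) b)) (at x)" by simp
  next
    fix v
    show "ck_on k S (\<lambda>x. \<Sum>b\<in>Basis. (?D x v \<bullet> b) *\<^sub>R ?E (f x) b)"
    proof (intro ck_on_sum[OF assms(1)] ck_on_bounded_bilinear[OF bounded_bilinear_scaleR assms(1)])
      fix b :: 'b
      show "ck_on k S (\<lambda>x. ?D x v \<bullet> b)"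
        using ck_on_bounded_linear[OF bounded_linear_inner_left assms(1) ck_on_SucD(2)[OF Suc.prems(1)]] .
      show "ck_on k S (\<lambda>x. ?E (f x) b)"
        using Suc.IH[OF ck_on_Suc_imp[OF Suc.prems(1)] ck_on_SucD(2)[OF Suc.prems(2)]] .
    qed
  qed
qed

lemma ck_on_id: "open S \<Longrightarrow> ck_on k S (\<lambda>x. x)"
proof (cases k)
  case (Suc j)
  assume "open S"
  then show ?thesis unfolding Suc
    by (rule ck_on_SucI) (auto intro: has_derivative_ident ck_on_const)
qed simp

lemma ck_on_inverse: "ck_on k {0<..} (inverse :: real \<Rightarrow> real)"
proof (induction k)
  case 0
  then show ?case by (auto intro!: continuous_on_inverse)
next
  case (Suc k)
  show ?case
  proof (rule ck_on_SucI)
    show "(inverse has_derivative (\<lambda>v. - (inverse x * v * inverse x))) (at x)" if "x \<in> {0<..}" for x :: real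
      by (rule has_derivative_inverse') (use that in auto)
    show "ck_on k {0<..} (\<lambda>x. - (inverse x * v * inverse x))" for v :: real
      by (intro ck_on_bounded_linear[OF bounded_linear_minus[OF bounded_linear_ident]]
          ck_on_bounded_bilinear[OF bounded_bilinear_mult] Suc ck_on_const) auto
  qed auto
qed

lemma ck_on_sqrt: "ck_on k {0<..} sqrt"
proof (induction k)
  case 0
  then show ?case by (auto intro!: continuous_intros)
next
  case (Suc k)
  show ?case
  proof (rule ck_on_SucI)
    show "(sqrt has_derivative (*) (inverse (sqrt x) / 2)) (at x)" if "x \<in> {0<..}" for x :: real
      using DERIV_real_sqrt[of x] that by (simp add: has_field_derivative_def)
    show "ck_on k {0<..} (\<lambda>x. inverse (sqrt x) / 2 * v)" for v :: real
      by (rule ck_on_bounded_linear[OF bounded_linear_mult_left], simp,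
          rule ck_on_bounded_linear[OF bounded_linear_divide], simp,
          rule ck_on_compose[of "{0<..}" "{0<..}" sqrt k inverse])
        (use Suc ck_on_inverse in auto)
  qed auto
qed

lemma smooth_on_cong:
  "open S \<Longrightarrow> (\<And>x. x \<in> S \<Longrightarrow> f x = g x) \<Longrightarrow> smooth_on S f \<Longrightarrow> smooth_on S g"
  unfolding smooth_on_def using ck_on_cong[of S f g] by blast

lemma smooth_on_subset: "smooth_on S f \<Longrightarrow> T \<subseteq> S \<Longrightarrow> smooth_on T f"
  unfolding smooth_on_def using ck_on_subset by blast

lemma smooth_on_empty: "smooth_on {} f"
proof -
  have "ck_on k {} f" for k
    by (induction k arbitrary: f) auto
  then show ?thesis by (simp add: smooth_on_def)
qed

lemma smooth_on_imp_continuous_on: "smooth_on S f \<Longrightarrow> continuous_on S f"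
  unfolding smooth_on_def using ck_on_imp_continuous_on by blast

lemma smooth_on_has_derivative:
  "smooth_on S f \<Longrightarrow> x \<in> S \<Longrightarrow> (f has_derivative frechet_derivative f (at x)) (at x)"
  using ck_on_SucD(1)[of 0 S f x] by (simp add: smooth_on_def)

lemma smooth_on_frechet_derivative:
  "smooth_on S f \<Longrightarrow> smooth_on S (\<lambda>x. frechet_derivative f (at x) v)"
  unfolding smooth_on_def using ck_on_SucD(2)[of _ S f v] by blast

lemma smooth_on_const: "smooth_on S (\<lambda>x. c)"
  by (simp add: smooth_on_def ck_on_const[of _ S c])

lemma smooth_on_id: "open S \<Longrightarrow> smooth_on S (\<lambda>x. x)"
  by (simp add: smooth_on_def ck_on_id[of S])

lemma smooth_on_bounded_linear:
  "bounded_linear L \<Longrightarrow> open S \<Longrightarrow> smooth_on S f \<Longrightarrow> smooth_on S (\<lambda>x. L (f x))"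
  by (simp add: smooth_on_def ck_on_bounded_linear[of L S _ f])

lemma smooth_on_bounded_bilinear:
  "bounded_bilinear B \<Longrightarrow> open S \<Longrightarrow> smooth_on S f \<Longrightarrow> smooth_on S g \<Longrightarrow>
    smooth_on S (\<lambda>x. B (f x) (g x))"
  by (simp add: smooth_on_def ck_on_bounded_bilinear[of B S _ f g])

lemma smooth_on_add:
  "open S \<Longrightarrow> smooth_on S f \<Longrightarrow> smooth_on S g \<Longrightarrow> smooth_on S (\<lambda>x. f x + g x)"
  by (simp add: smooth_on_def ck_on_add[of S _ f g])

lemma smooth_on_sum:
  "open S \<Longrightarrow> (\<And>i. i \<in> I \<Longrightarrow> smooth_on S (f i)) \<Longrightarrow> smooth_on S (\<lambda>x. \<Sum>i\<in>I. f i x)"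
  by (simp add: smooth_on_def ck_on_sum[of S I _ f])

lemma smooth_on_compose:
  "open S \<Longrightarrow> open T \<Longrightarrow> f ` S \<subseteq> T \<Longrightarrow> smooth_on S f \<Longrightarrow> smooth_on T g \<Longrightarrow>
    smooth_on S (\<lambda>x. g (f x))"
  by (simp add: smooth_on_def ck_on_compose[of S T f _ g])

lemmas smooth_on_scaleR = smooth_on_bounded_bilinear[OF bounded_bilinear_scaleR]
lemmas smooth_on_mult =
  smooth_on_bounded_bilinear[OF bounded_bilinear_mult[where ?'a = real]]
lemmas smooth_on_inner = smooth_on_bounded_bilinear[OF bounded_bilinear_inner]

lemma smooth_on_minus: "open S \<Longrightarrow> smooth_on S f \<Longrightarrow> smooth_on S (\<lambda>x. - f x)"
  by (rule smooth_on_bounded_linear[OF bounded_linear_minus[OF bounded_linear_ident]])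

lemma smooth_on_diff:
  "open S \<Longrightarrow> smooth_on S f \<Longrightarrow> smooth_on S g \<Longrightarrow> smooth_on S (\<lambda>x. f x - g x)"
  using smooth_on_add[OF _ _ smooth_on_minus, of S f g] by simp

lemma smooth_on_sqrt:
  "open S \<Longrightarrow> smooth_on S f \<Longrightarrow> (\<And>x. x \<in> S \<Longrightarrow> f x > 0) \<Longrightarrow> smooth_on S (\<lambda>x. sqrt (f x))"
  by (rule smooth_on_compose[where T = "{0<..}"]) (auto simp: smooth_on_def ck_on_sqrt)

lemma smooth_on_inverse:
  "open S \<Longrightarrow> smooth_on S f \<Longrightarrow> (\<And>x. x \<in> S \<Longrightarrow> f x > 0) \<Longrightarrow>
    smooth_on S (\<lambda>x. inverse (f x :: real))"
  by (rule smooth_on_compose[where T = "{0<..}"]) (auto simp: smooth_on_def ck_on_inverse)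

lemma smooth_on_norm:
  assumes "open S" and "smooth_on S f" and "\<And>x. x \<in> S \<Longrightarrow> f x \<noteq> 0"
  shows "smooth_on S (\<lambda>x. norm (f x))"
proof -
  have "smooth_on S (\<lambda>x. f x \<bullet> f x)"
    by (rule smooth_on_inner[OF assms(1,2,2)])
  then show ?thesis
    unfolding norm_eq_sqrt_inner by (rule smooth_on_sqrt[OF assms(1)]) (simp add: assms(3))
qed

lemma smooth_on_Pair:
  assumes "open S" and "smooth_on S f" and "smooth_on S g"
  shows "smooth_on S (\<lambda>x. (f x, g x))"
proof -
  have "smooth_on S (\<lambda>x. (f x, 0) + (0, g x))"
    by (rule smooth_on_add[OF assms(1)
          smooth_on_bounded_linear[OF _ assms(1,2)] smooth_on_bounded_linear[OF _ assms(1,3)]])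
      (intro bounded_linear_Pair bounded_linear_ident bounded_linear_zero)+
  then show ?thesis by simp
qed

lemma smooth_on_vec:
  fixes f :: "'n::finite \<Rightarrow> 'e::euclidean_space \<Rightarrow> real"
  assumes "open S" and "\<And>i. smooth_on S (f i)"
  shows "smooth_on S (\<lambda>x. \<chi> i. f i x)"
proof -
  have "smooth_on S (\<lambda>x. \<Sum>i\<in>UNIV. f i x *\<^sub>R (axis i 1 :: real^'n))"
    by (rule smooth_on_sum[OF assms(1) smooth_on_scaleR[OF assms smooth_on_const]])
  moreover have "(\<Sum>i\<in>UNIV. f i x *\<^sub>R (axis i 1 :: real^'n)) = (\<chi> i. f i x)" for x
    using basis_expansion[of "\<chi> i. f i x"] by (simp add: scalar_mult_eq_scaleR)
  ultimately show ?thesis by simp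
qed


section \<open>Charts and tangent vectors\<close>

locale smooth_atlas =
  fixes X :: "'a topology" and A :: "('a, 'e::euclidean_space) chart set"
  assumes maximal: "maximal_smooth_atlas X A"
begin

lemma chart: "c \<in> A \<Longrightarrow> topological_chart X c"
  and compatible: "c \<in> A \<Longrightarrow> d \<in> A \<Longrightarrow> smoothly_compatible c d"
  and charts_cover: "\<Union> (fst ` A) = topspace X"
  and chart_maximal: "topological_chart X c \<Longrightarrow> (\<And>d. d \<in> A \<Longrightarrow> smoothly_compatible c d) \<Longrightarrow> c \<in> A"
  using maximal by (simp_all add: maximal_smooth_atlas_def del: split_paired_All)

lemma chart_openin: "c \<in> A \<Longrightarrow> openin X (fst c)"
  and chart_homeomorphic:
    "c \<in> A \<Longrightarrow> homeomorphic_map (subtopology X (fst c)) (top_of_set (snd c ` fst c)) (snd c)"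
  and chart_open_range: "c \<in> A \<Longrightarrow> open (snd c ` fst c)"
  using chart unfolding topological_chart_def by blast+

lemma topspace_chart: "c \<in> A \<Longrightarrow> topspace (subtopology X (fst c)) = fst c"
  using openin_subset[OF chart_openin] by (simp add: inf.absorb2)

lemma chart_inj: "c \<in> A \<Longrightarrow> inj_on (snd c) (fst c)"
  using homeomorphic_imp_injective_map[OF chart_homeomorphic, of c] topspace_chart[of c] by (simp del: topspace_subtopology)

lemma chart_inv_chart [simp]: "c \<in> A \<Longrightarrow> p \<in> fst c \<Longrightarrow> chart_inv c (snd c p) = p"
  unfolding chart_inv_def using chart_inj by (simp add: inv_into_f_f)

lemma open_chart_image:
  assumes "c \<in> A" and "openin X W" and "W \<subseteq> fst c"
  shows "open (snd c ` W)"
proof -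
  have "openin (subtopology X (fst c)) W"
    using assms(2,3) by (auto simp: openin_subtopology)
  then have "openin (top_of_set (snd c ` fst c)) (snd c ` W)"
    using homeomorphic_map_openness[OF chart_homeomorphic, of c W] assms topspace_chart by blast
  then show ?thesis
    using chart_open_range[OF assms(1)] openin_open_trans by blast
qed

lemma openin_chart_preimage:
  assumes "c \<in> A" and "open T"
  shows "openin X {p \<in> fst c. snd c p \<in> T}"
proof -
  have "continuous_map (subtopology X (fst c)) (top_of_set (snd c ` fst c)) (snd c)"
    using chart_homeomorphic[OF assms(1)] homeomorphic_imp_continuous_map by blast
  moreover have "openin (top_of_set (snd c ` fst c)) (snd c ` fst c \<inter> T)"
    using assms(2) by blast
  ultimately have "openin (subtopology X (fst c))
      {p \<in> topspace (subtopology X (fst c)). snd c p \<in> snd c ` fst c \<inter> T}"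
    using openin_continuous_map_preimage by blast
  moreover have "{p \<in> topspace (subtopology X (fst c)). snd c p \<in> snd c ` fst c \<inter> T} =
      {p \<in> fst c. snd c p \<in> T}"
    using topspace_chart[OF assms(1)] by auto
  ultimately show ?thesis
    using openin_trans_full[OF _ chart_openin[OF assms(1)]] by simp
qed

lemma open_chart_overlap: "c \<in> A \<Longrightarrow> d \<in> A \<Longrightarrow> open (snd c ` (fst c \<inter> fst d))"
  by (rule open_chart_image) (auto intro: openin_Int chart_openin)

lemma smooth_transition:
  "c \<in> A \<Longrightarrow> d \<in> A \<Longrightarrow> smooth_on (snd c ` (fst c \<inter> fst d)) (transition c d)"
  using compatible unfolding smoothly_compatible_def by blast

lemma transition_chart: "c \<in> A \<Longrightarrow> p \<in> fst c \<Longrightarrow> transition c d (snd c p) = snd d p"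
  unfolding transition_def by simp

text \<open>Maximality is what makes the charts of \<open>A\<close> arbitrarily small.\<close>

lemma restrict_chart:
  assumes c: "c \<in> A" and W: "openin X W"
  shows "(fst c \<inter> W, snd c) \<in> A"
proof (rule chart_maximal)
  let ?c = "(fst c \<inter> W, snd c)"
  have op: "openin X (fst c \<inter> W)" using chart_openin[OF c] W by blast
  have "homeomorphic_map (subtopology (subtopology X (fst c)) W)
      (subtopology (top_of_set (snd c ` fst c)) (snd c ` (fst c \<inter> W))) (snd c)"
    by (rule homeomorphic_map_subtopologies[OF chart_homeomorphic[OF c]])
      (use topspace_chart[OF c] in auto)
  moreover have "snd c ` fst c \<inter> snd c ` (fst c \<inter> W) = snd c ` (fst c \<inter> W)" by blast
  ultimately have "homeomorphic_map (subtopology X (fst c \<inter> W))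
      (top_of_set (snd c ` (fst c \<inter> W))) (snd c)"
    by (simp add: subtopology_subtopology)
  then show "topological_chart X ?c"
    using op open_chart_image[OF c op] by (simp add: topological_chart_def)
  fix d assume d: "d \<in> A"
  have inv: "chart_inv ?c y = chart_inv c y" if y: "y \<in> snd c ` (fst c \<inter> W)" for y
  proof -
    obtain p where p: "p \<in> fst c" "p \<in> W" "y = snd c p" using y by blast
    have "inj_on (snd c) (fst c \<inter> W)" using chart_inj[OF c] by (rule inj_on_subset) blast
    then show ?thesis using p c by (simp add: chart_inv_def[of ?c] inv_into_f_f)
  qed
  have "smooth_on (snd c ` (fst c \<inter> W \<inter> fst d)) (transition c d)"
    by (rule smooth_on_subset[OF smooth_transition[OF c d]]) blast
  then have "smooth_on (snd c ` (fst c \<inter> W \<inter> fst d)) (transition ?c d)"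
    by (rule smooth_on_cong[rotated 2])
      (use inv open_chart_image[OF c, of "fst c \<inter> W \<inter> fst d"] op chart_openin[OF d]
        in \<open>auto simp: transition_def\<close>)
  moreover have "smooth_on (snd d ` (fst c \<inter> W \<inter> fst d)) (transition d c)"
    by (rule smooth_on_subset[OF smooth_transition[OF d c]]) blast
  ultimately show "smoothly_compatible ?c d"
    by (simp add: smoothly_compatible_def transition_def)
qed

abbreviation jacobian :: "('a, 'e) chart \<Rightarrow> ('a, 'e) chart \<Rightarrow> 'a \<Rightarrow> 'e \<Rightarrow> 'e" where
  "jacobian c d p \<equiv> frechet_derivative (transition c d) (at (snd c p))"

lemma transition_has_derivative:
  assumes "c \<in> A" and "d \<in> A" and "p \<in> fst c" and "p \<in> fst d"
  shows "(transition c d has_derivative jacobian c d p) (at (snd c p))"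
  using smooth_on_has_derivative[OF smooth_transition[OF assms(1,2)]] assms(3,4) by simp

lemma jacobian_linear:
  "c \<in> A \<Longrightarrow> d \<in> A \<Longrightarrow> p \<in> fst c \<Longrightarrow> p \<in> fst d \<Longrightarrow> linear (jacobian c d p)"
  using transition_has_derivative has_derivative_linear by blast

lemma jacobian_self:
  assumes "c \<in> A" and "p \<in> fst c"
  shows "jacobian c c p a = a"
proof -
  have "((\<lambda>x. x) has_derivative jacobian c c p) (at (snd c p))"
    by (rule has_derivative_transform_within_open
        [OF transition_has_derivative chart_open_range[of c]])
      (use assms in \<open>auto simp: transition_chart\<close>)
  then show ?thesis using has_derivative_unique[OF has_derivative_ident] by metis
qed

lemma jacobian_cocycle:
  assumes "c \<in> A" "d \<in> A" "e \<in> A" and "p \<in> fst c" "p \<in> fst d" "p \<in> fst e"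
  shows "jacobian d e p (jacobian c d p a) = jacobian c e p a"
proof -
  have "(transition d e has_derivative jacobian d e p) (at (transition c d (snd c p)))"
    using transition_has_derivative[of d e p] assms by (simp add: transition_chart)
  from has_derivative_compose[OF transition_has_derivative this]
  have "((\<lambda>x. transition d e (transition c d x)) has_derivative
      (\<lambda>a. jacobian d e p (jacobian c d p a))) (at (snd c p))"
    using assms by blast
  then have "(transition c e has_derivative (\<lambda>a. jacobian d e p (jacobian c d p a))) (at (snd c p))"
    by (rule has_derivative_transform_within_open[OF _ open_chart_overlap[of c d]])
      (use assms in \<open>auto simp: transition_chart\<close>)
  from has_derivative_unique[OF this transition_has_derivative[of c e p]] show ?thesis
    using assms by metis
qed

lemma tangent_component:
  "v \<in> tangent_space A p \<Longrightarrow> c \<in> A \<Longrightarrow> d \<in> A \<Longrightarrow> p \<in> fst c \<Longrightarrow> p \<in> fst d \<Longrightarrow>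
    v d = jacobian c d p (v c)"
  unfolding tangent_space_def by blast

lemma tangent_zero_outside:
  "v \<in> tangent_space A p \<Longrightarrow> d \<notin> A \<or> p \<notin> fst d \<Longrightarrow> v d = 0"
  unfolding tangent_space_def by blast

text \<open>Together with the next two lemmas this identifies the tangent space at \<open>p\<close> with the coordinate
  space of any chart around \<open>p\<close>; the cocycle identity of the Jacobians makes the families consistent.\<close>

lemma coord_tvec_tangent:
  assumes "c \<in> A" and "p \<in> fst c"
  shows "coord_tvec A c p a \<in> tangent_space A p"
  unfolding tangent_space_def
proof (intro CollectI conjI ballI allI impI)
  fix d e assume "d \<in> A" "e \<in> A" "p \<in> fst d" "p \<in> fst e"
  then show "coord_tvec A c p a e = jacobian d e p (coord_tvec A c p a d)"
    using jacobian_cocycle[of c d e p a] assms by (simp add: coord_tvec_def)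
qed (auto simp: coord_tvec_def)

lemma coord_tvec_component [simp]:
  "c \<in> A \<Longrightarrow> p \<in> fst c \<Longrightarrow> coord_tvec A c p a c = a"
  by (simp add: coord_tvec_def jacobian_self)

lemma coord_tvec_of_component:
  assumes "v \<in> tangent_space A p" and "c \<in> A" and "p \<in> fst c"
  shows "coord_tvec A c p (v c) = v"
proof
  fix d
  show "coord_tvec A c p (v c) d = v d"
    using tangent_component[OF assms(1,2), of d] tangent_zero_outside[OF assms(1), of d] assms(3)
    by (simp add: coord_tvec_def)
qed

lemma coord_tvec_add:
  assumes "c \<in> A" and "p \<in> fst c"
  shows "coord_tvec A c p (a + b) = tadd (coord_tvec A c p a) (coord_tvec A c p b)"
proof
  fix d
  show "coord_tvec A c p (a + b) d = tadd (coord_tvec A c p a) (coord_tvec A c p b) d"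
    using linear_add[OF jacobian_linear[of c d p]] assms by (simp add: coord_tvec_def tadd_def)
qed

lemma coord_tvec_scale:
  assumes "c \<in> A" and "p \<in> fst c"
  shows "coord_tvec A c p (r *\<^sub>R a) = tscale r (coord_tvec A c p a)"
proof
  fix d
  show "coord_tvec A c p (r *\<^sub>R a) d = tscale r (coord_tvec A c p a) d"
    using linear_scale[OF jacobian_linear[of c d p]] assms by (simp add: coord_tvec_def tscale_def)
qed

lemma tangent_tscale:
  assumes "c \<in> A" and "p \<in> fst c" and "v \<in> tangent_space A p"
  shows "tscale r v \<in> tangent_space A p"
  using coord_tvec_tangent[OF assms(1,2), of "r *\<^sub>R v c"] coord_tvec_scale[OF assms(1,2)]
    coord_tvec_of_component[OF assms(3,1,2)] by simp

text \<open>A tangent vector field is smooth as soon as its components in one chart are: in any other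
  chart they arise by applying the Jacobian, which depends smoothly on the point.\<close>

lemma smooth_vector_field_coord_tvec:
  assumes c: "c \<in> A" and W: "openin X W" "W \<subseteq> fst c" and w: "smooth_on (snd c ` W) w"
  shows "smooth_vector_field A W (\<lambda>p. coord_tvec A c p (w (snd c p)))"
  unfolding smooth_vector_field_def
proof (intro conjI ballI)
  show "coord_tvec A c p (w (snd c p)) \<in> tangent_space A p" if "p \<in> W" for p
    using that W c by (auto intro: coord_tvec_tangent)
  fix d assume d: "d \<in> A"
  let ?V = "fst d \<inter> W"
  have V: "openin X ?V" using W chart_openin[OF d] by blast
  have opc: "open (snd c ` ?V)" and opd: "open (snd d ` ?V)"
    using open_chart_image[OF _ V] c d W by blast+
  define k where "k z = (\<Sum>b\<in>Basis. (w z \<bullet> b) *\<^sub>R frechet_derivative (transition c d) (at z) b)" for z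
  have "smooth_on (snd c ` ?V) (\<lambda>z. frechet_derivative (transition c d) (at z) b)" for b
    by (rule smooth_on_subset[OF smooth_on_frechet_derivative[OF smooth_transition[OF c d]]])
      (use W in blast)
  moreover have "smooth_on (snd c ` ?V) (\<lambda>z. w z \<bullet> b)" for b
    by (rule smooth_on_bounded_linear[OF bounded_linear_inner_left opc smooth_on_subset[OF w]]) blast
  ultimately have k: "smooth_on (snd c ` ?V) k"
    unfolding k_def by (intro smooth_on_sum[OF opc] smooth_on_scaleR[OF opc])
  have "smooth_on (snd d ` ?V) (transition d c)"
    by (rule smooth_on_subset[OF smooth_transition[OF d c]]) (use W in blast)
  then have "smooth_on (snd d ` ?V) (\<lambda>y. k (transition d c y))"
    by (rule smooth_on_compose[OF opd opc _ _ k, rotated]) (use d in \<open>auto simp: transition_chart\<close>)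
  then show "smooth_on (snd d ` ?V) (\<lambda>y. coord_tvec A c (chart_inv d y) (w (snd c (chart_inv d y))) d)"
  proof (rule smooth_on_cong[OF opd, rotated])
    fix y assume "y \<in> snd d ` ?V"
    then obtain p where p: "p \<in> fst d" "p \<in> W" "y = snd d p" by blast
    have "jacobian c d p (w (snd c p)) = k (snd c p)"
      unfolding k_def using jacobian_linear[OF c d, of p] p W
      by (subst (1) euclidean_representation[symmetric]) (auto simp: linear_sum linear_scale)
    then show "k (transition d c y) = coord_tvec A c (chart_inv d y) (w (snd c (chart_inv d y))) d"
      using p d W(2) by (auto simp: transition_chart coord_tvec_def)
  qed
qed

lemma smooth_vector_field_component:
  assumes "smooth_vector_field A U W" and "c \<in> A"
  shows "smooth_on (snd c ` (fst c \<inter> U)) (\<lambda>x. W (chart_inv c x) c)"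
  using assms unfolding smooth_vector_field_def by blast

end


section \<open>Lorentzian linear algebra\<close>

text \<open>The time component \<open>a\<close> and the spatial components \<open>w\<close> are kept apart because only \<open>w\<close> serves as
  coordinates of a null vector.\<close>

definition frame_comb :: "'v::real_vector \<Rightarrow> (3 \<Rightarrow> 'v) \<Rightarrow> real \<Rightarrow> real^3 \<Rightarrow> 'v" where
  "frame_comb u0 u a w = a *\<^sub>R u0 + (\<Sum>i\<in>UNIV. w $ i *\<^sub>R u i)"

locale lorentz_frame =
  fixes B :: "real^4 \<Rightarrow> real^4 \<Rightarrow> real" and u0 :: "real^4" and u :: "3 \<Rightarrow> real^4"
  assumes bilin: "bilinear B" and sym: "B a b = B b a"
    and u0_u0: "B u0 u0 = - 1" and u0_u: "B u0 (u i) = 0"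
    and u_u: "B (u i) (u j) = (if i = j then 1 else 0)"
begin

abbreviation comb :: "real \<Rightarrow> real^3 \<Rightarrow> real^4" where
  "comb \<equiv> frame_comb u0 u"

lemma B_linear_left: "linear (\<lambda>x. B x y)"
  using bilin by (simp add: bilinear_def)

lemma B_comb_left: "B (comb a w) y = a * B u0 y + (\<Sum>i\<in>UNIV. w $ i * B (u i) y)"
  by (simp add: frame_comb_def linear_add[OF B_linear_left] linear_sum[OF B_linear_left]
      linear_scale[OF B_linear_left])

lemma B_comb_u0: "B (comb a w) u0 = - a"
  by (simp add: B_comb_left u0_u0 u0_u sym[of "u i" u0 for i])

lemma B_comb_u: "B (comb a w) (u i) = w $ i"
  by (simp add: B_comb_left u0_u u_u if_distrib cong: if_cong)

lemma B_comb_comb: "B (comb a w) (comb b z) = w \<bullet> z - a * b"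
proof -
  have "B u0 (comb b z) = - b" "B (u i) (comb b z) = z $ i" for i
    using B_comb_u0[of b z] B_comb_u[of b z i] sym by metis+
  then show ?thesis by (simp add: B_comb_left inner_vec_def)
qed

lemma comb_inject: "comb a w = comb b z \<Longrightarrow> a = b \<and> w = z"
  using B_comb_u0 B_comb_u by (metis neg_equal_iff_equal vec_eq_iff)

text \<open>Orthonormality makes the four legs independent, so by dimension they span.\<close>

lemma comb_expansion: "comb (- B v u0) (\<chi> i. B v (u i)) = v"
proof -
  define f where "f = (\<lambda>(a, w). comb a w)"
  have lin: "linear f"
    unfolding f_def frame_comb_def
    by (rule linearI) (auto simp: algebra_simps sum.distrib scaleR_sum_right)
  have "inj f"
    using comb_inject by (fastforce simp: f_def inj_on_def)
  then have "dim (range f) = DIM(real^4)"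
    using dim_image_eq[OF lin, of UNIV] by simp
  then have "span (range f) = UNIV"
    by (simp only: dim_eq_full)
  moreover have "span (range f) = range f"
    using linear_subspace_image[OF lin subspace_UNIV] by (simp add: span_eq_iff)
  ultimately have "range f = UNIV" by simp
  then obtain a w where "v = comb a w"
    unfolding f_def by (metis UNIV_I imageE case_prod_beta)
  then show ?thesis by (simp add: B_comb_u0 B_comb_u)
qed

lemma timelike_not_orthogonal:
  assumes "B t t < 0"
  shows "B u0 t \<noteq> 0"
proof
  assume "B u0 t = 0"
  then have "t = comb 0 (\<chi> i. B t (u i))"
    using comb_expansion[of t] sym by simp
  then have "B t t \<ge> 0" by (metis B_comb_comb diff_zero inner_ge_zero mult_zero_left)
  with assms show False by simp
qed

text \<open>By the Cauchy-Schwarz inequality the spatial part of \<open>t\<close>, shorter than its time component,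
  cannot outweigh the latter in the product with a null vector.\<close>

lemma null_direction:
  assumes t: "B t t < 0" "B u0 t < 0" and w: "w \<noteq> 0" and s: "s \<in> {1, - 1}"
  shows "s * B (comb (s * norm w) w) t < 0"
proof -
  obtain b z where bz: "t = comb b z" using comb_expansion by metis
  have b: "b > 0" using t(2) B_comb_u0[of b z] sym bz by simp
  have "z \<bullet> z < b * b" using t(1) B_comb_comb bz by simp
  then have zb: "norm z < b"
    using b by (simp add: norm_eq_sqrt_inner real_less_lsqrt power2_eq_square)
  have "s * (w \<bullet> z) \<le> \<bar>w \<bullet> z\<bar>" using s by auto
  also have "\<dots> \<le> norm w * norm z" by (rule Cauchy_Schwarz_ineq2)
  also have "\<dots> < norm w * b" using w zb by simp
  finally have "s * (w \<bullet> z) < norm w * b" .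
  moreover have "s * s = 1" using s by auto
  ultimately show ?thesis
    unfolding bz B_comb_comb by (simp add: right_diff_distrib mult.assoc[symmetric])
qed

lemma null_comb: "s \<in> {1, - 1} \<Longrightarrow> B (comb (s * norm w) w) (comb (s * norm w) w) = 0"
  unfolding B_comb_comb by (auto simp: dot_square_norm power2_eq_square)

lemma null_form:
  assumes v: "B v v = 0" "v \<noteq> 0" and t: "B t t < 0" "B u0 t < 0"
  obtains s w where "s \<in> {1, - 1}" and "w \<noteq> 0" and "v = comb (s * norm w) w"
proof -
  obtain a w where aw: "v = comb a w" using comb_expansion by metis
  have "a * a = norm w * norm w"
    using v(1) by (simp add: aw B_comb_comb dot_square_norm power2_eq_square)
  then have "a = norm w \<or> a = - norm w" using square_eq_iff by blast
  then obtain s where s: "s \<in> {1, - 1}" "a = s * norm w" by force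
  have "w \<noteq> 0"
  proof
    assume "w = 0"
    then have "v = 0" using aw s by (simp add: frame_comb_def)
    with v(2) show False ..
  qed
  with s aw that show thesis by blast
qed

end

section \<open>Smooth Gram-Schmidt orthonormalisation\<close>

lemma bilinear_expand:
  fixes B :: "'e::euclidean_space \<Rightarrow> 'e \<Rightarrow> real"
  assumes "bilinear B"
  shows "B v w = (\<Sum>a\<in>Basis. \<Sum>b\<in>Basis. (v \<bullet> a) * ((w \<bullet> b) * B a b))"
proof -
  have l: "linear (\<lambda>x. B x y)" "linear (B y)" for y using assms by (auto simp: bilinear_def)
  have "B v w = B (\<Sum>a\<in>Basis. (v \<bullet> a) *\<^sub>R a) (\<Sum>b\<in>Basis. (w \<bullet> b) *\<^sub>R b)"
    by (simp add: euclidean_representation)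
  also have "\<dots> = (\<Sum>a\<in>Basis. (v \<bullet> a) * B a (\<Sum>b\<in>Basis. (w \<bullet> b) *\<^sub>R b))"
    by (simp only: linear_sum[OF l(1)] linear_scale[OF l(1)] real_scaleR_def)
  also have "\<dots> = (\<Sum>a\<in>Basis. (v \<bullet> a) * (\<Sum>b\<in>Basis. (w \<bullet> b) * B a b))"
    by (simp only: linear_sum[OF l(2)] linear_scale[OF l(2)] real_scaleR_def)
  finally show ?thesis by (simp add: sum_distrib_left)
qed

text \<open>A smoothly varying symmetric bilinear form, as given by the components of a metric in a chart.\<close>

locale smooth_form =
  fixes S :: "'e::euclidean_space set" and B :: "'e \<Rightarrow> 'e \<Rightarrow> 'e \<Rightarrow> real"
  assumes open_S: "open S"
    and bilin: "x \<in> S \<Longrightarrow> bilinear (B x)"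
    and sym: "x \<in> S \<Longrightarrow> B x a b = B x b a"
    and smooth_coeff: "a \<in> Basis \<Longrightarrow> b \<in> Basis \<Longrightarrow> smooth_on S (\<lambda>x. B x a b)"
begin

lemma smooth_apply:
  assumes "open T" and "T \<subseteq> S" and v: "smooth_on T v" and w: "smooth_on T w"
  shows "smooth_on T (\<lambda>x. B x (v x) (w x))"
proof -
  have "smooth_on T (\<lambda>x. \<Sum>a\<in>Basis. \<Sum>b\<in>Basis. (v x \<bullet> a) * ((w x \<bullet> b) * B x a b))"
  proof (rule smooth_on_sum[OF assms(1)], rule smooth_on_sum[OF assms(1)])
    fix a b :: 'e assume "a \<in> Basis" "b \<in> Basis"
    then have "smooth_on T (\<lambda>x. B x a b)"
      using smooth_on_subset[OF smooth_coeff assms(2)] by blast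
    then show "smooth_on T (\<lambda>x. (v x \<bullet> a) * ((w x \<bullet> b) * B x a b))"
      by (rule smooth_on_mult[OF assms(1) smooth_on_bounded_linear[OF bounded_linear_inner_left assms(1) v]
            smooth_on_mult[OF assms(1) smooth_on_bounded_linear[OF bounded_linear_inner_left assms(1) w]]])
  qed
  then show ?thesis
    by (rule smooth_on_cong[OF assms(1), rotated])
      (use assms(2) bilinear_expand[OF bilin] in \<open>auto intro: sym\<close>)
qed

definition orthonormal_fields ::
    "'i set \<Rightarrow> ('i \<Rightarrow> real) \<Rightarrow> 'e set \<Rightarrow> ('i \<Rightarrow> 'e \<Rightarrow> 'e) \<Rightarrow> bool" where
  "orthonormal_fields I \<epsilon> T u \<longleftrightarrow> (\<forall>i\<in>I. smooth_on T (u i)) \<and>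
     (\<forall>x\<in>T. \<forall>i\<in>I. \<forall>j\<in>I. B x (u i x) (u j x) = (if i = j then \<epsilon> i else 0))"

text \<open>The vectors are taken as constant fields and orthonormalised one after the other.
  At \<open>x0\<close> nothing changes, because they are already orthonormal there. So the squared lengths of
  the vectors to be normalised equal \<open>\<plusminus>1\<close> at \<open>x0\<close>, and nearby they keep their sign.\<close>

lemma extend_orthonormal:
  assumes "finite I" and "x0 \<in> S" and "\<And>i. i \<in> I \<Longrightarrow> \<epsilon> i \<in> {1, - 1}"
    and "\<And>i j. i \<in> I \<Longrightarrow> j \<in> I \<Longrightarrow> B x0 (E i) (E j) = (if i = j then \<epsilon> i else 0)"
  shows "\<exists>T u. open T \<and> x0 \<in> T \<and> T \<subseteq> S \<and> orthonormal_fields I \<epsilon> T u \<and> (\<forall>i\<in>I. u i x0 = E i)"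
  using assms
proof (induction I rule: finite_induct)
  case empty
  then show ?case using open_S by (auto simp: orthonormal_fields_def)
next
  case (insert k I)
  then obtain T u where T: "open T" "x0 \<in> T" "T \<subseteq> S" and on: "orthonormal_fields I \<epsilon> T u"
    and u0: "\<forall>i\<in>I. u i x0 = E i"
    by (metis insertCI)
  have eps: "\<epsilon> i * \<epsilon> i = 1" if "i \<in> insert k I" for i using insert.prems(2)[OF that] by auto
  have u_smooth: "smooth_on T (u i)" if "i \<in> I" for i
    using on that by (simp add: orthonormal_fields_def)
  have u_on: "B x (u i x) (u j x) = (if i = j then \<epsilon> i else 0)" if "x \<in> T" "i \<in> I" "j \<in> I" for x i j
    using on that by (simp add: orthonormal_fields_def)
  define t where "t x = E k - (\<Sum>i\<in>I. (\<epsilon> i * B x (E k) (u i x)) *\<^sub>R u i x)" for x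
  define N where "N x = \<epsilon> k * B x (t x) (t x)" for x
  define T' where "T' = {x \<in> T. N x > 0}"
  define v where "v x = inverse (sqrt (N x)) *\<^sub>R t x" for x
  have t_smooth: "smooth_on T t"
    unfolding t_def
    by (intro smooth_on_diff[OF T(1) smooth_on_const] smooth_on_sum[OF T(1)]
        smooth_on_scaleR[OF T(1)] smooth_on_mult[OF T(1) smooth_on_const]
        smooth_apply[OF T(1,3) smooth_on_const] u_smooth)
  have N_smooth: "smooth_on T N"
    unfolding N_def
    by (rule smooth_on_mult[OF T(1) smooth_on_const smooth_apply[OF T(1,3) t_smooth t_smooth]])
  have t_orth: "B x (t x) (u j x) = 0" if x: "x \<in> T" and j: "j \<in> I" for x j
  proof -
    have l: "linear (\<lambda>y. B x y (u j x))" using bilin x T(3) by (auto simp: bilinear_def)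
    have "B x (t x) (u j x) = B x (E k) (u j x) -
        (\<Sum>i\<in>I. (\<epsilon> i * B x (E k) (u i x)) * B x (u i x) (u j x))"
      by (simp add: t_def linear_diff[OF l] linear_sum[OF l] linear_scale[OF l])
    also have "(\<Sum>i\<in>I. (\<epsilon> i * B x (E k) (u i x)) * B x (u i x) (u j x)) =
        (\<Sum>i\<in>I. if i = j then (\<epsilon> j * \<epsilon> j) * B x (E k) (u j x) else 0)"
      by (rule sum.cong) (use u_on x j in auto)
    also have "\<dots> = B x (E k) (u j x)"
      using j insert.hyps(1) eps by simp
    finally show ?thesis by simp
  qed
  have t0: "t x0 = E k"
    using insert.hyps(2) insert.prems(3)[of k] u0 by (auto simp: t_def intro!: sum.neutral)
  have N0: "N x0 = 1"
    using insert.prems(3)[of k k] eps[of k] by (simp add: N_def t0)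
  have T': "open T'" "x0 \<in> T'" "T' \<subseteq> T"
  proof -
    have "T' = T \<inter> N -` {0<..}" by (auto simp: T'_def)
    then show "open T'"
      using continuous_open_preimage[OF smooth_on_imp_continuous_on[OF N_smooth] T(1)] by simp
  qed (use T N0 in \<open>auto simp: T'_def\<close>)
  have v_smooth: "smooth_on T' v"
    unfolding v_def
    by (intro smooth_on_scaleR[OF T'(1)] smooth_on_inverse[OF T'(1)] smooth_on_sqrt[OF T'(1)]
        smooth_on_subset[OF N_smooth T'(3)] smooth_on_subset[OF t_smooth T'(3)])
      (auto simp: T'_def)
  have v_orth: "B x (v x) (u j x) = 0" "B x (u j x) (v x) = 0" if "x \<in> T'" "j \<in> I" for x j
  proof -
    have x: "x \<in> S" "x \<in> T" using that T T' by auto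
    have l: "linear (\<lambda>y. B x y (u j x))" using bilin x by (auto simp: bilinear_def)
    show "B x (v x) (u j x) = 0"
      using t_orth[OF x(2) that(2)] by (simp add: v_def linear_scale[OF l])
    then show "B x (u j x) (v x) = 0" using sym[OF x(1)] by metis
  qed
  have v_unit: "B x (v x) (v x) = \<epsilon> k" if "x \<in> T'" for x
  proof -
    have "x \<in> S" and N: "N x > 0" using that T T' by (auto simp: T'_def)
    then have l: "linear (\<lambda>y. B x y z)" "linear (B x z)" for z
      using bilin by (auto simp: bilinear_def)
    have "B x (v x) (v x) = inverse (sqrt (N x)) * (inverse (sqrt (N x)) * B x (t x) (t x))"
      by (simp add: v_def linear_scale[OF l(1)] linear_scale[OF l(2)])
    also have "\<dots> = B x (t x) (t x) / N x"
      using N by (simp add: divide_simps)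
    also have "B x (t x) (t x) \<noteq> 0" using N by (auto simp: N_def)
    then have "B x (t x) (t x) / N x = \<epsilon> k"
      using N eps[of k] by (auto simp: N_def divide_simps mult.assoc[symmetric])
    finally show ?thesis .
  qed
  have "orthonormal_fields (insert k I) \<epsilon> T' (u(k := v))"
    unfolding orthonormal_fields_def
    using insert.hyps(2) v_smooth smooth_on_subset[OF u_smooth T'(3)] v_unit v_orth u_on T'(3)
    by (auto simp: subset_iff)
  moreover have "v x0 = E k" by (simp add: v_def N0 t0)
  then have "\<forall>i\<in>insert k I. (u(k := v)) i x0 = E i"
    using u0 by simp
  ultimately show ?case using T T' by (metis order_trans)
qed

end


section \<open>Smooth orthonormal frames on a spacetime\<close>

locale lorentz_spacetime =
  fixes X :: "'a topology" and A :: "('a, real^4) chart set"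
    and g :: "'a metric" and \<tau> :: "'a \<Rightarrow> 'a tv"
  assumes spacetime: "spacetime X A g \<tau>"
begin

sublocale smooth_atlas X A
  using spacetime by unfold_locales (simp add: spacetime_def smooth_manifold_def)

lemma chart_topspace: "c \<in> A \<Longrightarrow> p \<in> fst c \<Longrightarrow> p \<in> topspace X"
  using charts_cover by blast

lemma metric_sym:
  assumes "p \<in> topspace X" and "u \<in> tangent_space A p" and "v \<in> tangent_space A p"
  shows "g p u v = g p v u"
  using spacetime assms
  by (simp add: spacetime_def lorentzian_metric_def symmetric_bilinear_on_tangent_def)

lemma metric_linear:
  assumes "p \<in> topspace X" and "u \<in> tangent_space A p" "v \<in> tangent_space A p" "w \<in> tangent_space A p"
  shows "g p (tadd (tscale r u) (tscale s v)) w = r * g p u w + s * g p v w"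
  using spacetime assms
  by (simp add: spacetime_def lorentzian_metric_def symmetric_bilinear_on_tangent_def)

lemma metric_add:
  assumes "p \<in> topspace X" and "u \<in> tangent_space A p" "v \<in> tangent_space A p" "w \<in> tangent_space A p"
  shows "g p (tadd u v) w = g p u w + g p v w"
  using metric_linear[OF assms, of 1 1] by (simp add: tscale_def)

lemma metric_scale:
  assumes "p \<in> topspace X" and "u \<in> tangent_space A p" "w \<in> tangent_space A p"
  shows "g p (tscale r u) w = r * g p u w"
  using metric_linear[OF assms(1,2,2,3), of r 0] by (simp add: tscale_def tadd_def)

text \<open>The metric at \<open>p\<close> transported to the coordinate space of \<open>c\<close>, where linear algebra and calculus
  take place.\<close>

definition gram :: "('a, real^4) chart \<Rightarrow> 'a \<Rightarrow> real^4 \<Rightarrow> real^4 \<Rightarrow> real" where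
  "gram c p a b = g p (coord_tvec A c p a) (coord_tvec A c p b)"

lemma gram_sym: "c \<in> A \<Longrightarrow> p \<in> fst c \<Longrightarrow> gram c p a b = gram c p b a"
  unfolding gram_def by (intro metric_sym chart_topspace coord_tvec_tangent)

lemma gram_bilinear:
  assumes "c \<in> A" and "p \<in> fst c"
  shows "bilinear (gram c p)"
proof -
  note t = coord_tvec_tangent[OF assms]
  have left: "linear (\<lambda>a. gram c p a b)" for b
    by (rule linearI)
      (simp_all add: gram_def coord_tvec_add[OF assms] coord_tvec_scale[OF assms]
        metric_add[OF chart_topspace[OF assms] t t t] metric_scale[OF chart_topspace[OF assms] t t])
  moreover have "gram c p b = (\<lambda>a. gram c p a b)" for b
    using gram_sym[OF assms] by blast
  ultimately show ?thesis unfolding bilinear_def by metis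
qed

lemma metric_eq_gram:
  assumes "c \<in> A" and "p \<in> fst c" and "v \<in> tangent_space A p" "w \<in> tangent_space A p"
  shows "g p v w = gram c p (v c) (w c)"
  using coord_tvec_of_component[OF _ assms(1,2)] assms(3,4) by (simp add: gram_def)

lemma gram_smooth_form:
  assumes "c \<in> A"
  shows "smooth_form (snd c ` fst c) (\<lambda>x. gram c (chart_inv c x))"
proof
  show "open (snd c ` fst c)" using chart_open_range[OF assms] .
  show "bilinear (gram c (chart_inv c x))" "gram c (chart_inv c x) a b = gram c (chart_inv c x) b a"
    if "x \<in> snd c ` fst c" for x a b
    using that assms gram_bilinear[OF assms] gram_sym[OF assms] by auto
  show "smooth_on (snd c ` fst c) (\<lambda>x. gram c (chart_inv c x) a b)"
    if "a \<in> Basis" "b \<in> Basis" for a b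
    using spacetime assms that by (simp add: spacetime_def lorentzian_metric_def gram_def Let_def)
qed

lemma lorentz_frame_component:
  assumes "c \<in> A" and "p \<in> fst c" and "orthonormal_at A g p e0 e"
  shows "lorentz_frame (gram c p) (e0 c) (\<lambda>i. e i c)"
  using assms gram_bilinear[OF assms(1,2)] gram_sym[OF assms(1,2)] metric_eq_gram[OF assms(1,2)]
  by unfold_locales (auto simp: orthonormal_at_def)

lemma tau_tangent: "p \<in> topspace X \<Longrightarrow> \<tau> p \<in> tangent_space A p"
  and tau_timelike: "p \<in> topspace X \<Longrightarrow> g p (\<tau> p) (\<tau> p) < 0"
  and tau_smooth: "smooth_vector_field A (topspace X) \<tau>"
  using spacetime by (auto simp: spacetime_def smooth_vector_field_def)

definition framed ::
    "('a, real^4) chart \<Rightarrow> ('a \<Rightarrow> 'a tv) \<Rightarrow> (3 \<Rightarrow> 'a \<Rightarrow> 'a tv) \<Rightarrow> bool" where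
  "framed c e0 e \<longleftrightarrow> c \<in> A \<and> future_frame A g \<tau> (fst c) e0 e"

text \<open>Gram-Schmidt is applied to an orthonormal basis at \<open>p\<close> whose timelike leg is future directed; the
  leg stays future directed nearby by continuity.\<close>

lemma exists_framed_chart:
  assumes p: "p \<in> topspace X"
  shows "\<exists>c e0 e. framed c e0 e \<and> p \<in> fst c"
proof -
  obtain c where c: "c \<in> A" "p \<in> fst c" using p charts_cover by blast
  obtain E0 E where "orthonormal_at A g p E0 E"
    using spacetime p unfolding spacetime_def lorentzian_metric_def by blast
  then interpret E: lorentz_frame "gram c p" "E0 c" "\<lambda>i. E i c"
    by (rule lorentz_frame_component[OF c])
  interpret F: smooth_form "snd c ` fst c" "\<lambda>x. gram c (chart_inv c x)"
    by (rule gram_smooth_form[OF c(1)])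
  have "gram c p (\<tau> p c) (\<tau> p c) < 0"
    using tau_timelike[OF p] metric_eq_gram[OF c] tau_tangent[OF p] by simp
  then have nz: "gram c p (E0 c) (\<tau> p c) \<noteq> 0" by (rule E.timelike_not_orthogonal)
  \<comment> \<open>the sign that makes the timelike leg future directed\<close>
  define r :: real where "r = (if gram c p (E0 c) (\<tau> p c) < 0 then 1 else - 1)"
  define \<epsilon> :: "3 option \<Rightarrow> real" where "\<epsilon> k = (if k = None then - 1 else 1)" for k
  define L where "L k = (case k of None \<Rightarrow> r *\<^sub>R E0 c | Some i \<Rightarrow> E i c)" for k
  have l: "linear (\<lambda>y. gram c p y z)" "linear (gram c p z)" for z
    using E.bilin by (auto simp: bilinear_def)
  have L: "gram c p (L i) (L j) = (if i = j then \<epsilon> i else 0)" for i j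
    using E.sym[of "E _ c" "E0 c"]
    by (cases i; cases j)
      (simp_all add: L_def \<epsilon>_def linear_scale[OF l(1)] linear_scale[OF l(2)] E.u0_u0 E.u0_u E.u_u r_def)
  have "\<exists>T u. open T \<and> snd c p \<in> T \<and> T \<subseteq> snd c ` fst c \<and>
      F.orthonormal_fields UNIV \<epsilon> T u \<and> (\<forall>i\<in>UNIV. u i (snd c p) = L i)"
    by (rule F.extend_orthonormal) (use L c in \<open>auto simp: \<epsilon>_def\<close>)
  then obtain T u where T: "open T" "snd c p \<in> T" "T \<subseteq> snd c ` fst c"
    and u: "F.orthonormal_fields UNIV \<epsilon> T u" and up: "u k (snd c p) = L k" for k
    by blast
  define H where "H x = gram c (chart_inv c x) (u None x) (\<tau> (chart_inv c x) c)" for x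
  have u_smooth: "smooth_on T (u k)" for k
    using u by (simp add: F.orthonormal_fields_def)
  have tau_T: "smooth_on T (\<lambda>x. \<tau> (chart_inv c x) c)"
    by (rule smooth_on_subset[OF smooth_vector_field_component[OF tau_smooth c(1)]])
      (use T(3) chart_topspace[OF c(1)] in blast)
  have H_smooth: "smooth_on T H"
    unfolding H_def by (rule F.smooth_apply[OF T(1,3) u_smooth tau_T])
  define T' where "T' = T \<inter> H -` {..<0}"
  have T': "open T'"
    using continuous_open_preimage[OF smooth_on_imp_continuous_on[OF H_smooth] T(1)]
    by (simp add: T'_def)
  have "H (snd c p) < 0"
    using nz by (simp add: H_def c up L_def linear_scale[OF l(1)] r_def)
  then have pT': "snd c p \<in> T'" using T by (simp add: T'_def)
  define W where "W = {q \<in> fst c. snd c q \<in> T'}"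
  have W: "openin X W" "W \<subseteq> fst c" "p \<in> W"
    using openin_chart_preimage[OF c(1) T'] c pT' by (auto simp: W_def)
  define e where "e k q = coord_tvec A c q (u k (snd c q))" for k q
  have "(fst c \<inter> W, snd c) \<in> A" by (rule restrict_chart[OF c(1) W(1)])
  then have W_chart: "(W, snd c) \<in> A" using W(2) by (simp add: inf.absorb2)
  have "smooth_vector_field A W (e k)" for k
    unfolding e_def
    by (rule smooth_vector_field_coord_tvec[OF c(1) W(1,2) smooth_on_subset[OF u_smooth]])
      (auto simp: W_def T'_def)
  moreover have "orthonormal_at A g q (e None q) (\<lambda>i. e (Some i) q) \<and> future_directed g \<tau> q (e None q)"
    if q: "q \<in> W" for q
  proof -
    have qc: "q \<in> fst c" "snd c q \<in> T" "H (snd c q) < 0" using q by (auto simp: W_def T'_def)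
    have tan: "e k q \<in> tangent_space A q" for k
      unfolding e_def by (rule coord_tvec_tangent[OF c(1) qc(1)])
    have comp: "e k q c = u k (snd c q)" for k
      unfolding e_def by (rule coord_tvec_component[OF c(1) qc(1)])
    have "g q (e i q) (e j q) = (if i = j then \<epsilon> i else 0)" for i j
    proof -
      have "g q (e i q) (e j q) = gram c (chart_inv c (snd c q)) (u i (snd c q)) (u j (snd c q))"
        using metric_eq_gram[OF c(1) qc(1) tan tan] comp c qc by simp
      then show ?thesis using u qc(2) by (simp add: F.orthonormal_fields_def)
    qed
    moreover have "g q (e None q) (\<tau> q) < 0"
      using metric_eq_gram[OF c(1) qc(1) tan tau_tangent[OF chart_topspace[OF c(1) qc(1)]]] comp qc(3) c qc(1)
      by (simp add: H_def)
    ultimately show ?thesis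
      using tan by (simp add: orthonormal_at_def future_directed_def \<epsilon>_def)
  qed
  ultimately have "framed (W, snd c) (e None) (\<lambda>i. e (Some i))"
    using W_chart by (simp add: framed_def future_frame_def)
  then show ?thesis using W(3) by (metis fst_conv)
qed

section \<open>Natural charts of the null tangent bundle\<close>

text \<open>\<open>s = 1\<close> selects the future directed and \<open>s = - 1\<close> the past directed null vectors.\<close>

definition null_part :: "real \<Rightarrow> 'a set \<Rightarrow> ('a \<times> 'a tv) set" where
  "null_part s U = {(p, v) \<in> null_bundle X A g. p \<in> U \<and> s * g p v (\<tau> p) < 0}"

definition null_coords ::
    "('a, real^4) chart \<Rightarrow> ('a \<Rightarrow> 'a tv) \<Rightarrow> (3 \<Rightarrow> 'a \<Rightarrow> 'a tv) \<Rightarrow>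
     'a \<times> 'a tv \<Rightarrow> (real^4) \<times> (real^3)" where
  "null_coords c e0 e = (\<lambda>(p, v). (snd c p, spatial_components (e0 p) (\<lambda>i. e i p) v))"

lemma directed_part:
  "{(p, v) \<in> null_bundle X A g. p \<in> U \<and> future_directed g \<tau> p v} = null_part 1 U"
  "{(p, v) \<in> null_bundle X A g. p \<in> U \<and> past_directed g \<tau> p v} = null_part (- 1) U"
  by (simp_all add: null_part_def future_directed_def past_directed_def)

lemma natural_charts_intro:
  assumes "s \<in> {1, - 1}" and "framed c e0 e"
  shows "(null_part s (fst c), null_coords c e0 e) \<in> natural_charts X A g \<tau>"
proof -
  define directed :: "'a metric \<Rightarrow> ('a \<Rightarrow> 'a tv) \<Rightarrow> 'a \<Rightarrow> 'a tv \<Rightarrow> bool"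
    where "directed = (if s = 1 then future_directed else past_directed)"
  have "null_part s (fst c) = {(p, v) \<in> null_bundle X A g. p \<in> fst c \<and> directed g \<tau> p v}"
    using assms(1) by (cases "s = 1") (simp_all add: directed_def directed_part)
  moreover have "directed \<in> {future_directed, past_directed}" by (simp add: directed_def)
  moreover have "(fst c, snd c) \<in> A" "future_frame A g \<tau> (fst c) e0 e"
    using assms(2) by (simp_all add: framed_def)
  ultimately show ?thesis
    unfolding natural_charts_def null_coords_def
    by (intro CollectI exI[of _ "fst c"] exI[of _ "snd c"] exI[of _ e0] exI[of _ e]
        exI[of _ directed] conjI) (simp_all only:)
qed

lemma natural_charts_cases:
  assumes "(D, \<xi>) \<in> natural_charts X A g \<tau>"
  obtains s c e0 e where "s \<in> {1, - 1}" and "framed c e0 e"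
    and "D = null_part s (fst c)" and "\<xi> = null_coords c e0 e"
proof -
  from assms obtain U x e0 e directed where
    D: "D = {(p, v) \<in> null_bundle X A g. p \<in> U \<and> directed g \<tau> p v}"
    and \<xi>: "\<xi> = (\<lambda>(p, v). (x p, spatial_components (e0 p) (\<lambda>i. e i p) v))"
    and U: "(U, x) \<in> A" "future_frame A g \<tau> U e0 e"
    and dir: "directed \<in> {future_directed, past_directed}"
    unfolding natural_charts_def by (elim CollectE exE conjE Pair_inject)
  have c: "framed (U, x) e0 e" "\<xi> = null_coords (U, x) e0 e"
    using U by (simp_all add: framed_def null_coords_def \<xi>)
  consider "directed = future_directed" | "directed = past_directed" using dir by auto
  then show thesis
  proof cases
    case 1
    then show thesis using that[of 1 "(U, x)" e0 e] c D directed_part(1)[of U] by simp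
  next
    case 2
    then show thesis using that[of "- 1" "(U, x)" e0 e] c D directed_part(2)[of U] by simp
  qed
qed

lemma null_bundle_iff:
  "(p, v) \<in> null_bundle X A g \<longleftrightarrow>
    p \<in> topspace X \<and> v \<in> tangent_space A p \<and> g p v v = 0 \<and> v \<noteq> tzero"
  by (auto simp: null_bundle_def null_vectors_def)

text \<open>The inverse of \<open>null_coords\<close> on the fibre over \<open>p\<close>: the time component is determined by the
  spatial components \<open>w\<close> and the direction \<open>s\<close>.\<close>

definition null_vec ::
    "real \<Rightarrow> ('a, real^4) chart \<Rightarrow> ('a \<Rightarrow> 'a tv) \<Rightarrow> (3 \<Rightarrow> 'a \<Rightarrow> 'a tv) \<Rightarrow> 'a \<Rightarrow> real^3 \<Rightarrow> 'a tv" where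
  "null_vec s c e0 e p w = coord_tvec A c p (frame_comb (e0 p c) (\<lambda>i. e i p c) (s * norm w) w)"

context
  fixes c e0 e p
  assumes framed: "framed c e0 e" and p: "p \<in> fst c"
begin

lemma framed_chart: "c \<in> A"
  using framed by (simp add: framed_def)

lemma framed_topspace: "p \<in> topspace X"
  using chart_topspace[OF framed_chart p] .

lemma framed_orthonormal: "orthonormal_at A g p (e0 p) (\<lambda>i. e i p)"
  using framed p by (simp add: framed_def future_frame_def)

lemma frame_tangent: "e0 p \<in> tangent_space A p" "e i p \<in> tangent_space A p"
  using framed_orthonormal by (simp_all add: orthonormal_at_def)

interpretation F: lorentz_frame "gram c p" "e0 p c" "\<lambda>i. e i p c"
  using lorentz_frame_component[OF framed_chart p framed_orthonormal] .

lemma gram_tau: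
  shows "gram c p (\<tau> p c) (\<tau> p c) < 0" and "gram c p (e0 p c) (\<tau> p c) < 0"
proof -
  note t = metric_eq_gram[OF framed_chart p _ tau_tangent[OF framed_topspace]]
  show "gram c p (\<tau> p c) (\<tau> p c) < 0"
    using tau_timelike[OF framed_topspace] t[OF tau_tangent[OF framed_topspace]] by simp
  have "g p (e0 p) (\<tau> p) < 0"
    using framed p by (simp add: framed_def future_frame_def future_directed_def)
  then show "gram c p (e0 p c) (\<tau> p c) < 0"
    using t[OF frame_tangent(1)] by simp
qed

lemma null_vec_tangent: "null_vec s c e0 e p w \<in> tangent_space A p"
  unfolding null_vec_def by (rule coord_tvec_tangent[OF framed_chart p])

lemma null_vec_component: "null_vec s c e0 e p w c = F.comb (s * norm w) w"
  unfolding null_vec_def by (rule coord_tvec_component[OF framed_chart p])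

lemma null_vec_in_null_part:
  assumes "s \<in> {1, - 1}" and "w \<noteq> 0"
  shows "(p, null_vec s c e0 e p w) \<in> null_part s (fst c)"
proof -
  let ?v = "null_vec s c e0 e p w"
  have dir: "s * g p ?v (\<tau> p) < 0"
    using F.null_direction[OF gram_tau assms(2,1)]
    by (simp add: metric_eq_gram[OF framed_chart p null_vec_tangent tau_tangent[OF framed_topspace]]
        null_vec_component)
  have "g p ?v ?v = 0"
    using F.null_comb[OF assms(1)]
    by (simp add: metric_eq_gram[OF framed_chart p null_vec_tangent null_vec_tangent]
        null_vec_component)
  moreover have "?v \<noteq> tzero"
  proof
    assume "?v = tzero"
    then have "?v c = 0" by (simp add: tzero_def)
    then have "g p ?v (\<tau> p) = 0"
      using bilinear_lzero[OF F.bilin]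
      by (simp add: metric_eq_gram[OF framed_chart p null_vec_tangent tau_tangent[OF framed_topspace]])
    with dir show False by simp
  qed
  ultimately show ?thesis
    using dir p framed_topspace null_vec_tangent by (simp add: null_part_def null_bundle_iff)
qed

text \<open>Every non-zero null vector has a direction \<open>s\<close>, which is why the two natural charts over a framed
  chart domain cover its whole preimage in the bundle.\<close>

lemma null_bundle_cases:
  assumes "(p, v) \<in> null_bundle X A g"
  obtains s w where "s \<in> {1, - 1}" and "w \<noteq> 0" and "v = null_vec s c e0 e p w"
proof -
  have v: "v \<in> tangent_space A p" "g p v v = 0" "v \<noteq> tzero"
    using assms by (simp_all add: null_bundle_iff)
  have vc: "coord_tvec A c p (v c) = v" using coord_tvec_of_component[OF v(1) framed_chart p] .
  have "v c \<noteq> 0"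
  proof
    assume "v c = 0"
    then have "v d = 0" for d
      using tangent_component[OF v(1) framed_chart, of d] tangent_zero_outside[OF v(1), of d] p
        linear_0[OF jacobian_linear[OF framed_chart, of d p]] by metis
    with v(3) show False by (auto simp: tzero_def)
  qed
  moreover have "gram c p (v c) (v c) = 0"
    using v metric_eq_gram[OF framed_chart p] by simp
  ultimately obtain s w where "s \<in> {1, - 1}" "w \<noteq> 0" "v c = F.comb (s * norm w) w"
    using F.null_form gram_tau by metis
  with that show thesis using vc by (metis null_vec_def)
qed

lemma null_part_cases:
  assumes "(p, v) \<in> null_part s (fst c)" and s: "s \<in> {1, - 1}"
  obtains w where "w \<noteq> 0" and "v = null_vec s c e0 e p w"
proof -
  have v: "(p, v) \<in> null_bundle X A g" "s * g p v (\<tau> p) < 0"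
    using assms(1) by (simp_all add: null_part_def)
  obtain s' w where w: "s' \<in> {1, - 1}" "w \<noteq> 0" "v = null_vec s' c e0 e p w"
    using null_bundle_cases[OF v(1)] by metis
  have "s' * g p v (\<tau> p) < 0"
    using null_vec_in_null_part[OF w(1,2)] by (simp add: null_part_def w(3))
  then have "s' = s" using v(2) s w(1) by auto
  with w that show thesis by blast
qed

text \<open>The expansion of \<open>v\<close> in the frame is an identity between families over all charts; it holds
  as soon as it holds in the chart \<open>c\<close>, where the orthonormality relations give the coefficients.\<close>

lemma spatial_components_eq:
  assumes v: "v \<in> tangent_space A p"
  shows "spatial_components (e0 p) (\<lambda>i. e i p) v = (\<chi> i. g p v (e i p))"
proof -
  have *: "v = (\<lambda>d. a *\<^sub>R e0 p d + (\<Sum>i\<in>UNIV. w $ i *\<^sub>R e i p d)) \<longleftrightarrow> v c = F.comb a w" for a w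
  proof
    assume "v c = F.comb a w"
    show "v = (\<lambda>d. a *\<^sub>R e0 p d + (\<Sum>i\<in>UNIV. w $ i *\<^sub>R e i p d))"
    proof
      fix d
      show "v d = a *\<^sub>R e0 p d + (\<Sum>i\<in>UNIV. w $ i *\<^sub>R e i p d)"
      proof (cases "d \<in> A \<and> p \<in> fst d")
        case True
        note t = tangent_component[OF _ framed_chart _ p, of _ d]
        note l = jacobian_linear[OF framed_chart _ p, of d]
        have "v d = jacobian c d p (F.comb a w)"
          using t[OF v] True \<open>v c = F.comb a w\<close> by simp
        also have "\<dots> = a *\<^sub>R jacobian c d p (e0 p c) + (\<Sum>i\<in>UNIV. w $ i *\<^sub>R jacobian c d p (e i p c))"
          using True by (simp add: frame_comb_def linear_add[OF l] linear_sum[OF l] linear_scale[OF l])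
        finally show ?thesis
          using t[OF frame_tangent(1)] t[OF frame_tangent(2)] True by simp
      next
        case False
        then have "v d = 0" "e0 p d = 0" "e i p d = 0" for i
          using tangent_zero_outside[of _ p d] v frame_tangent by blast+
        then show ?thesis by simp
      qed
    qed
  qed (simp add: frame_comb_def)
  have comp: "g p v (e i p) = gram c p (v c) (e i p c)" for i
    by (rule metric_eq_gram[OF framed_chart p v frame_tangent(2)])
  show ?thesis
    unfolding spatial_components_def *
  proof (rule the_equality)
    show "\<exists>a. v c = F.comb a (\<chi> i. g p v (e i p))"
      using F.comb_expansion[of "v c"] by (simp add: comp) metis
    show "w = (\<chi> i. g p v (e i p))" if w: "\<exists>a. v c = F.comb a w" for w
    proof -
      obtain a where "v c = F.comb a w" using w by blast
      then show ?thesis using F.B_comb_u[of a w] by (simp add: comp)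
    qed
  qed
qed

lemma spatial_components_null_vec:
  "spatial_components (e0 p) (\<lambda>i. e i p) (null_vec s c e0 e p w) = w"
  by (simp add: spatial_components_eq[OF null_vec_tangent] null_vec_component F.B_comb_u
      metric_eq_gram[OF framed_chart p null_vec_tangent frame_tangent(2)])

lemma spatial_components_tscale:
  assumes v: "v \<in> tangent_space A p"
  shows "spatial_components (e0 p) (\<lambda>i. e i p) (tscale l v) =
    l *\<^sub>R spatial_components (e0 p) (\<lambda>i. e i p) v"
  by (simp add: spatial_components_eq v tangent_tscale[OF framed_chart p v] vec_eq_iff
      metric_scale[OF framed_topspace v frame_tangent(2)])

lemma metric_null_vec:
  assumes y: "y \<in> tangent_space A p"
  shows "g p (null_vec s c e0 e p w) y =
    s * norm w * gram c p (e0 p c) (y c) + (\<Sum>j\<in>UNIV. w $ j * gram c p (e j p c) (y c))"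
  by (simp add: metric_eq_gram[OF framed_chart p null_vec_tangent y] null_vec_component F.B_comb_left)

end

lemma null_coords_null_vec:
  "framed c e0 e \<Longrightarrow> p \<in> fst c \<Longrightarrow> null_coords c e0 e (p, null_vec s c e0 e p w) = (snd c p, w)"
  by (simp add: null_coords_def spatial_components_null_vec)

lemma null_coords_inj:
  assumes "framed c e0 e" and "s \<in> {1, - 1}"
  shows "inj_on (null_coords c e0 e) (null_part s (fst c))"
proof (rule inj_onI, clarify)
  fix p v q w
  assume pv: "(p, v) \<in> null_part s (fst c)" and qw: "(q, w) \<in> null_part s (fst c)"
    and eq: "null_coords c e0 e (p, v) = null_coords c e0 e (q, w)"
  have pq: "p \<in> fst c" "q \<in> fst c" using pv qw by (auto simp: null_part_def)
  moreover have "snd c p = snd c q" using eq by (simp add: null_coords_def)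
  ultimately have "p = q"
    using chart_inj[of c] assms(1) by (auto simp: framed_def inj_on_def)
  obtain a b where "v = null_vec s c e0 e p a" "w = null_vec s c e0 e q b"
    using null_part_cases[OF assms(1) pq(1) pv assms(2)] null_part_cases[OF assms(1) pq(2) qw assms(2)]
    by metis
  with eq pq \<open>p = q\<close> show "p = q \<and> v = w"
    using assms(1) by (simp add: null_coords_null_vec)
qed

lemma natural_charts_cover: "\<Union> (fst ` natural_charts X A g \<tau>) = null_bundle X A g"
proof
  show "\<Union> (fst ` natural_charts X A g \<tau>) \<subseteq> null_bundle X A g"
    by (force elim!: natural_charts_cases simp: null_part_def)
  show "null_bundle X A g \<subseteq> \<Union> (fst ` natural_charts X A g \<tau>)"
  proof clarify
    fix p v assume pv: "(p, v) \<in> null_bundle X A g"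
    then obtain c e0 e where c: "framed c e0 e" "p \<in> fst c"
      using exists_framed_chart by (metis null_bundle_iff)
    obtain s w where "s \<in> {1, - 1}" "w \<noteq> 0" "v = null_vec s c e0 e p w"
      using null_bundle_cases[OF c pv] by metis
    then have "(p, v) \<in> null_part s (fst c)" using null_vec_in_null_part[OF c] by simp
    moreover have "(null_part s (fst c), null_coords c e0 e) \<in> natural_charts X A g \<tau>"
      using \<open>s \<in> {1, - 1}\<close> c(1) by (rule natural_charts_intro)
    ultimately show "(p, v) \<in> \<Union> (fst ` natural_charts X A g \<tau>)"
      by (metis UN_I fst_conv)
  qed
qed

end

section \<open>The scaling action\<close>

lemma group_pos_reals: "group pos_reals"
proof (rule groupI)
  fix x assume "x \<in> carrier pos_reals"
  then show "\<exists>y\<in>carrier pos_reals. y \<otimes>\<^bsub>pos_reals\<^esub> x = \<one>\<^bsub>pos_reals\<^esub>"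
    by (intro bexI[of _ "inverse x"]) (auto simp: pos_reals_def)
qed (auto simp: pos_reals_def)

context lorentz_spacetime
begin

text \<open>The restriction to the null bundle is what membership in \<open>Bij\<close>, a set of extensional maps,
  requires.\<close>

definition rescale :: "real \<Rightarrow> 'a \<times> 'a tv \<Rightarrow> 'a \<times> 'a tv" where
  "rescale l = restrict (\<lambda>(p, v). (p, tscale l v)) (null_bundle X A g)"

lemma rescale_apply: "(p, v) \<in> null_bundle X A g \<Longrightarrow> rescale l (p, v) = (p, tscale l v)"
  by (simp add: rescale_def)

lemma rescale_in_null_bundle:
  assumes "l > 0" and "(p, v) \<in> null_bundle X A g"
  shows "(p, tscale l v) \<in> null_bundle X A g"
proof -
  have v: "p \<in> topspace X" "v \<in> tangent_space A p" "g p v v = 0" "v \<noteq> tzero"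
    using assms(2) by (simp_all add: null_bundle_iff)
  obtain c where c: "c \<in> A" "p \<in> fst c" using v(1) charts_cover by blast
  note lv = tangent_tscale[OF c v(2)]
  have "g p (tscale l v) (tscale l v) = l * (l * g p v v)"
    using metric_scale[OF v(1,2) lv] metric_sym[OF v(1,2) lv] metric_scale[OF v(1,2,2)] by simp
  moreover have "tscale l v \<noteq> tzero"
    using v(4) assms(1) by (auto simp: tscale_def tzero_def fun_eq_iff)
  ultimately show ?thesis using v lv by (simp add: null_bundle_iff)
qed

lemma rescale_direction:
  assumes "(p, v) \<in> null_bundle X A g"
  shows "g p (tscale l v) (\<tau> p) = l * g p v (\<tau> p)"
  using assms by (intro metric_scale tau_tangent) (simp_all add: null_bundle_iff)

lemma rescale_null_part:
  assumes "l > 0" and "(p, v) \<in> null_part s U"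
  shows "(p, tscale l v) \<in> null_part s U"
proof -
  have v: "(p, v) \<in> null_bundle X A g" "p \<in> U" "s * g p v (\<tau> p) < 0"
    using assms(2) by (simp_all add: null_part_def)
  have "l * (s * g p v (\<tau> p)) < 0" using v(3) assms(1) by (simp add: mult_pos_neg)
  then have "s * g p (tscale l v) (\<tau> p) < 0"
    using rescale_direction[OF v(1), of l] by (simp add: mult.left_commute)
  then show ?thesis
    using rescale_in_null_bundle[OF assms(1) v(1)] v(2) by (simp add: null_part_def)
qed

lemma group_action_rescale: "group_action pos_reals (null_bundle X A g) rescale"
proof -
  let ?N = "null_bundle X A g"
  have carrier: "carrier pos_reals = {0<..}" by (simp add: pos_reals_def)
  have N: "rescale l q \<in> ?N" if "l > 0" "q \<in> ?N" for l q
    using that rescale_in_null_bundle rescale_apply by (cases q) simp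
  have mult: "rescale (l * m) q = rescale l (rescale m q)" if "l > 0" "m > 0" "q \<in> ?N" for l m q
    using that rescale_in_null_bundle[of m "fst q" "snd q"]
    by (cases q) (simp add: rescale_apply tscale_def)
  have one: "rescale 1 q = q" if "q \<in> ?N" for q
    using that by (cases q) (simp add: rescale_apply tscale_def)
  have bij: "rescale l \<in> Bij ?N" if "l > 0" for l
  proof -
    have "bij_betw (rescale l) ?N ?N"
      using that N mult[of l "inverse l"] mult[of "inverse l" l] one
      by (intro bij_betw_byWitness[where f' = "rescale (inverse l)"]) auto
    then show ?thesis by (simp add: Bij_def rescale_def)
  qed
  have "rescale \<in> hom pos_reals (BijGroup ?N)"
  proof (rule homI)
    fix l m assume "l \<in> carrier pos_reals" "m \<in> carrier pos_reals"
    then have lm: "l > 0" "m > 0" by (auto simp: carrier)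
    have "rescale (l * m) = compose ?N (rescale l) (rescale m)"
    proof
      fix q
      show "rescale (l * m) q = compose ?N (rescale l) (rescale m) q"
        using mult[OF lm, of q] by (cases "q \<in> ?N") (simp_all add: compose_def rescale_def)
    qed
    then show "rescale (l \<otimes>\<^bsub>pos_reals\<^esub> m) = rescale l \<otimes>\<^bsub>BijGroup ?N\<^esub> rescale m"
      using bij lm by (simp add: BijGroup_def pos_reals_def)
  qed (use bij in \<open>simp add: carrier BijGroup_def\<close>)
  then show ?thesis
    unfolding group_action_def group_hom_def group_hom_axioms_def
    using group_pos_reals group_BijGroup by blast
qed

lemma rescale_null_coords:
  assumes "framed c e0 e" and "l > 0" and q: "q \<in> null_part s (fst c)"
  shows "rescale l q \<in> null_part s (fst c)"
    and "null_coords c e0 e (rescale l q) =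
      (fst (null_coords c e0 e q), l *\<^sub>R snd (null_coords c e0 e q))"
proof -
  obtain p v where pv: "q = (p, v)" by (cases q)
  have v: "(p, v) \<in> null_bundle X A g" "p \<in> fst c" "v \<in> tangent_space A p"
    using q by (simp_all add: pv null_part_def null_bundle_iff)
  show "rescale l q \<in> null_part s (fst c)"
    using rescale_null_part[OF assms(2)] q by (simp add: pv rescale_apply[OF v(1)])
  show "null_coords c e0 e (rescale l q) =
      (fst (null_coords c e0 e q), l *\<^sub>R snd (null_coords c e0 e q))"
    using spatial_components_tscale[OF assms(1) v(2,3)]
    by (simp add: pv rescale_apply[OF v(1)] null_coords_def)
qed

lemma smooth_gram_fields:
  assumes "c \<in> A" and "smooth_vector_field A U v" and "smooth_vector_field A V w"
    and S: "open S" "S \<subseteq> snd c ` (fst c \<inter> U \<inter> V)"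
  shows "smooth_on S (\<lambda>x. gram c (chart_inv c x) (v (chart_inv c x) c) (w (chart_inv c x) c))"
proof (rule smooth_form.smooth_apply[OF gram_smooth_form[OF assms(1)] S(1)])
  show "S \<subseteq> snd c ` fst c" using S(2) by blast
  show "smooth_on S (\<lambda>x. v (chart_inv c x) c)"
    by (rule smooth_on_subset[OF smooth_vector_field_component[OF assms(2,1)]]) (use S(2) in blast)
  show "smooth_on S (\<lambda>x. w (chart_inv c x) c)"
    by (rule smooth_on_subset[OF smooth_vector_field_component[OF assms(3,1)]]) (use S(2) in blast)
qed

lemma rescale_chart_domain:
  assumes c: "framed c e0 e" and d: "framed d f0 f" and s: "s \<in> {1, - 1}"
  shows "map_prod (\<lambda>r. r) (null_coords c e0 e) `
      {(l, q) \<in> {0<..} \<times> null_part s (fst c). rescale l q \<in> null_part s (fst d)} =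
    {0<..} \<times> (snd c ` (fst c \<inter> fst d) \<times> - {0})" (is "?\<phi> ` ?D = ?R")
proof (intro equalityI subsetI)
  fix z assume "z \<in> ?\<phi> ` ?D"
  then obtain l p v where z: "z = (l, null_coords c e0 e (p, v))" and l: "l > 0"
    and v: "(p, v) \<in> null_part s (fst c)" and lv: "rescale l (p, v) \<in> null_part s (fst d)"
    by (elim imageE CollectE case_prodE conjE SigmaE) (simp, metis surj_pair)
  have p: "p \<in> fst c" "(p, v) \<in> null_bundle X A g" using v by (auto simp: null_part_def)
  have "p \<in> fst d" using lv by (simp add: rescale_apply[OF p(2)] null_part_def)
  moreover obtain w where "w \<noteq> 0" "v = null_vec s c e0 e p w"
    using null_part_cases[OF c p(1) v s] by metis
  ultimately show "z \<in> ?R"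
    using l p(1) null_coords_null_vec[OF c p(1)] by (simp add: z)
next
  fix z assume "z \<in> ?R"
  then obtain l p w where z: "z = (l, (snd c p, w))" and l: "l > 0" and w: "w \<noteq> 0"
    and p: "p \<in> fst c" "p \<in> fst d"
    by auto
  let ?v = "null_vec s c e0 e p w"
  have v: "(p, ?v) \<in> null_part s (fst c)" by (rule null_vec_in_null_part[OF c p(1) s w])
  then have "(p, ?v) \<in> null_part s (fst d)" using p(2) by (simp add: null_part_def)
  from rescale_null_part[OF l this] have "rescale l (p, ?v) \<in> null_part s (fst d)"
    using v by (simp add: rescale_apply null_part_def)
  then have "(l, (p, ?v)) \<in> ?D" using l v by simp
  moreover have "z = ?\<phi> (l, (p, ?v))"
    using null_coords_null_vec[OF c p(1)] by (simp add: z)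
  ultimately show "z \<in> ?\<phi> ` ?D" by (rule rev_image_eqI)
qed

text \<open>The components of a null vector in the second frame are its inner products with the second
  spatial legs. They are therefore linear in its components in the first frame, with
  coefficients depending smoothly on the point, and the time component \<open>\<plusminus>norm w\<close> is smooth because
  \<open>w\<close> does not vanish.\<close>

lemma rescale_smooth_same_direction:
  assumes c: "framed c e0 e" and d: "framed d f0 f" and s: "s \<in> {1, - 1}"
  defines "R \<equiv> {0<..} \<times> (snd c ` (fst c \<inter> fst d) \<times> - {0})"
  shows "open R"
    and "smooth_on R (null_coords d f0 f \<circ> (\<lambda>(l, q). rescale l q) \<circ>
      inv_into ({0<..} \<times> null_part s (fst c)) (map_prod (\<lambda>r. r) (null_coords c e0 e)))"
proof -
  let ?V = "fst c \<inter> fst d" and ?\<phi> = "map_prod (\<lambda>r::real. r) (null_coords c e0 e)"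
  let ?O = "snd c ` ?V"
  have cA: "c \<in> A" and dA: "d \<in> A" using c d by (simp_all add: framed_def)
  have O: "open ?O" by (rule open_chart_overlap[OF cA dA])
  show R: "open R" unfolding R_def by (intro open_Times O) auto
  define G where "G v i x = gram c (chart_inv c x) (v (chart_inv c x) c) (f i (chart_inv c x) c)"
    for v :: "'a \<Rightarrow> 'a tv" and i x
  have G: "smooth_on ?O (G v i)" if "smooth_vector_field A (fst c) v" for v i
    unfolding G_def
  proof (rule smooth_gram_fields[OF cA that _ O])
    show "smooth_vector_field A (fst d) (f i)"
      using d by (simp add: framed_def future_frame_def)
  qed simp
  have base: "smooth_on R (\<lambda>z. k (fst (snd z)))" if "smooth_on ?O k" for k :: "real^4 \<Rightarrow> 'n::euclidean_space"
  proof (rule smooth_on_compose[OF R O _ _ that])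
    show "smooth_on R (\<lambda>z. fst (snd z))"
      by (rule smooth_on_bounded_linear[OF bounded_linear_compose[OF bounded_linear_fst bounded_linear_snd]
            R smooth_on_id[OF R]])
  qed (auto simp: R_def)
  have scal: "smooth_on R (\<lambda>z. fst z)"
    by (rule smooth_on_bounded_linear[OF bounded_linear_fst R smooth_on_id[OF R]])
  have fibre: "smooth_on R (\<lambda>z. snd (snd z))"
    by (rule smooth_on_bounded_linear[OF bounded_linear_compose[OF bounded_linear_snd bounded_linear_snd]
          R smooth_on_id[OF R]])
  have coeff: "smooth_on R (\<lambda>z. snd (snd z) $ j)" for j
    by (rule smooth_on_bounded_linear[OF bounded_linear_vec_nth R fibre])
  have norm: "smooth_on R (\<lambda>z. norm (snd (snd z)))"
    by (rule smooth_on_norm[OF R fibre]) (auto simp: R_def)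
  define H where "H = (\<lambda>z. (transition c d (fst (snd z)),
      \<chi> i. fst z * (s * norm (snd (snd z)) * G e0 i (fst (snd z)) +
        (\<Sum>j\<in>UNIV. snd (snd z) $ j * G (e j) i (fst (snd z))))))"
  have "smooth_on R H"
    unfolding H_def
  proof (rule smooth_on_Pair[OF R base smooth_on_vec[OF R smooth_on_mult[OF R scal
          smooth_on_add[OF R _ smooth_on_sum[OF R]]]]])
    show "smooth_on ?O (transition c d)" by (rule smooth_transition[OF cA dA])
    show "smooth_on R (\<lambda>z. s * norm (snd (snd z)) * G e0 i (fst (snd z)))" for i
      by (rule smooth_on_mult[OF R smooth_on_mult[OF R smooth_on_const norm] base[OF G]])
        (use c in \<open>simp add: framed_def future_frame_def\<close>)
    show "smooth_on R (\<lambda>z. snd (snd z) $ j * G (e j) i (fst (snd z)))" for i j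
      by (rule smooth_on_mult[OF R coeff base[OF G]])
        (use c in \<open>simp add: framed_def future_frame_def\<close>)
  qed
  then show "smooth_on R (null_coords d f0 f \<circ> (\<lambda>(l, q). rescale l q) \<circ>
      inv_into ({0<..} \<times> null_part s (fst c)) ?\<phi>)"
  proof (rule smooth_on_cong[OF R, rotated])
    fix z assume "z \<in> R"
    then obtain l p w where z: "z = (l, (snd c p, w))" and l: "l > 0" and w: "w \<noteq> 0"
      and p: "p \<in> fst c" "p \<in> fst d"
      by (auto simp: R_def)
    let ?v = "null_vec s c e0 e p w"
    have v: "(p, ?v) \<in> null_part s (fst c)" by (rule null_vec_in_null_part[OF c p(1) s w])
    then have vN: "(p, ?v) \<in> null_bundle X A g" by (simp add: null_part_def)
    note vT = null_vec_tangent[OF c p(1)]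
    have "inj_on ?\<phi> ({0<..} \<times> null_part s (fst c))"
      using map_prod_inj_on[of "\<lambda>r. r" "{0<..}", OF _ null_coords_inj[OF c s]] by simp
    then have inv: "inv_into ({0<..} \<times> null_part s (fst c)) ?\<phi> z = (l, (p, ?v))"
      by (rule inv_into_f_eq) (use l v null_coords_null_vec[OF c p(1)] in \<open>auto simp: z\<close>)
    have "spatial_components (f0 p) (\<lambda>i. f i p) (tscale l ?v) = (\<chi> i. l * g p ?v (f i p))"
      by (simp add: spatial_components_tscale[OF d p(2) vT] spatial_components_eq[OF d p(2) vT] vec_eq_iff)
    then have "H z = null_coords d f0 f (p, tscale l ?v)"
      using p cA
      by (simp add: null_coords_def H_def z G_def transition_chart
          metric_null_vec[OF c p(1) frame_tangent(2)[OF d p(2)]])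
    then show "H z = (null_coords d f0 f \<circ> (\<lambda>(l, q). rescale l q) \<circ>
        inv_into ({0<..} \<times> null_part s (fst c)) ?\<phi>) z"
      by (simp only: o_apply inv case_prod_conv rescale_apply[OF vN])
  qed
qed

text \<open>Charts of opposite directions never meet under the action, so their transition is empty.\<close>

lemma rescale_preserves_direction:
  assumes "l > 0" and "s \<in> {1, - 1}" and "s' \<in> {1, - 1}"
    and "q \<in> null_part s U" and "rescale l q \<in> null_part s' V"
  shows "s = s'"
proof -
  obtain p v where q: "q = (p, v)" by (cases q)
  have "rescale l (p, v) = (p, tscale l v)"
    using assms(4) by (simp add: q rescale_apply null_part_def)
  then have "(p, tscale l v) \<in> null_part s' V" "(p, tscale l v) \<in> null_part s U"
    using assms rescale_null_part[OF assms(1)] by (simp_all add: q)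
  then show ?thesis using assms(2,3) by (auto simp: null_part_def)
qed

lemma smooth_map_rescale:
  "smooth_map (carrier pos_reals \<times> null_bundle X A g)
      (product_atlas pos_reals_atlas (natural_charts X A g \<tau>))
      (null_bundle X A g) (natural_charts X A g \<tau>) (\<lambda>(l, q). rescale l q)"
proof -
  have carrier: "carrier pos_reals = {0<..}" by (simp add: pos_reals_def)
  have product: "product_atlas pos_reals_atlas (natural_charts X A g \<tau>) =
      {({0<..} \<times> D, map_prod (\<lambda>r. r) \<xi>) | D \<xi>. (D, \<xi>) \<in> natural_charts X A g \<tau>}"
    by (auto simp: product_atlas_def pos_reals_atlas_def)
  have "\<Union> (fst ` product_atlas pos_reals_atlas (natural_charts X A g \<tau>)) =
      {0<..} \<times> \<Union> (fst ` natural_charts X A g \<tau>)"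
    unfolding product by force
  then have cover: "\<Union> (fst ` product_atlas pos_reals_atlas (natural_charts X A g \<tau>)) =
      {0<..} \<times> null_bundle X A g"
    by (simp only: natural_charts_cover)
  have image: "(\<lambda>(l, q). rescale l q) ` ({0<..} \<times> null_bundle X A g) \<subseteq> null_bundle X A g"
    using rescale_in_null_bundle by (auto simp: rescale_apply)
  have local_smooth: "open (\<phi> ` {z \<in> D. (\<lambda>(l, q). rescale l q) z \<in> D'}) \<and>
      smooth_on (\<phi> ` {z \<in> D. (\<lambda>(l, q). rescale l q) z \<in> D'}) (\<psi> \<circ> (\<lambda>(l, q). rescale l q) \<circ> inv_into D \<phi>)"
    if D: "(D, \<phi>) \<in> product_atlas pos_reals_atlas (natural_charts X A g \<tau>)"
      and D': "(D', \<psi>) \<in> natural_charts X A g \<tau>" for D \<phi> D' \<psi>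
  proof -
    obtain D0 \<xi> where D0: "(D0, \<xi>) \<in> natural_charts X A g \<tau>"
      and D_D0: "D = {0<..} \<times> D0" "\<phi> = map_prod (\<lambda>r. r) \<xi>"
      using D unfolding product by blast
    obtain s c e0 e where c: "framed c e0 e" and s: "s \<in> {1, - 1}"
      and D_eq: "D = {0<..} \<times> null_part s (fst c)" "\<phi> = map_prod (\<lambda>r. r) (null_coords c e0 e)"
      using natural_charts_cases[OF D0] D_D0 by metis
    obtain s' d f0 f where d: "framed d f0 f" and s': "s' \<in> {1, - 1}"
      and D'_eq: "D' = null_part s' (fst d)" "\<psi> = null_coords d f0 f"
      using natural_charts_cases[OF D'] by metis
    have dom: "{z \<in> D. (\<lambda>(l, q). rescale l q) z \<in> D'} =
        {(l, q) \<in> {0<..} \<times> null_part s (fst c). rescale l q \<in> null_part s' (fst d)}"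
      by (auto simp: D_eq D'_eq)
    show ?thesis
    proof (cases "s = s'")
      case True
      have "\<phi> ` {z \<in> D. (\<lambda>(l, q). rescale l q) z \<in> D'} =
          {0<..} \<times> (snd c ` (fst c \<inter> fst d) \<times> - {0})"
        unfolding dom D_eq(2) True[symmetric] by (rule rescale_chart_domain[OF c d s])
      then show ?thesis
        using rescale_smooth_same_direction[OF c d s] unfolding D_eq D'_eq by simp
    next
      case False
      then have "{z \<in> D. (\<lambda>(l, q). rescale l q) z \<in> D'} = {}"
        using rescale_preserves_direction[OF _ s s'] unfolding dom by auto
      then show ?thesis by (simp only: image_empty open_empty smooth_on_empty)
    qed
  qed
  show ?thesis
    unfolding smooth_map_def carrier
    by (intro conjI image cover natural_charts_cover, clarify) (rule local_smooth)
qed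

end

theorem mainTheorem3:
  fixes X :: "'a topology" and A :: "('a, real^4) chart set"
    and g :: "'a metric" and \<tau> :: "'a \<Rightarrow> 'a tv"
  assumes "spacetime X A g \<tau>"
  shows "\<exists>h :: real \<Rightarrow> 'a \<times> 'a tv \<Rightarrow> 'a \<times> 'a tv.
    group_action pos_reals (null_bundle X A g) h \<and>
    smooth_map (carrier pos_reals \<times> null_bundle X A g)
      (product_atlas pos_reals_atlas (natural_charts X A g \<tau>))
      (null_bundle X A g) (natural_charts X A g \<tau>)
      (\<lambda>(l, q). h l q) \<and>
    (\<forall>l\<in>carrier pos_reals. \<forall>(D, \<xi>)\<in>natural_charts X A g \<tau>. \<forall>q\<in>D.
      h l q \<in> D \<and> \<xi> (h l q) = (fst (\<xi> q), l *\<^sub>R snd (\<xi> q)))"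
proof -
  interpret lorentz_spacetime X A g \<tau>
    using assms by (rule lorentz_spacetime.intro)
  have "rescale l q \<in> D \<and> \<xi> (rescale l q) = (fst (\<xi> q), l *\<^sub>R snd (\<xi> q))"
    if "l \<in> carrier pos_reals" and D: "(D, \<xi>) \<in> natural_charts X A g \<tau>" and "q \<in> D" for l D \<xi> q
  proof -
    obtain s c e0 e where "framed c e0 e" "D = null_part s (fst c)" "\<xi> = null_coords c e0 e"
      using natural_charts_cases[OF D] by metis
    then show ?thesis
      using rescale_null_coords[of c e0 e l q s] that by (simp add: pos_reals_def)
  qed
  then have "\<forall>l\<in>carrier pos_reals. \<forall>(D, \<xi>)\<in>natural_charts X A g \<tau>. \<forall>q\<in>D.
      rescale l q \<in> D \<and> \<xi> (rescale l q) = (fst (\<xi> q), l *\<^sub>R snd (\<xi> q))"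
    by blast
  with group_action_rescale smooth_map_rescale show ?thesis by blast
qed

end
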